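(* Let $n$ be a non-negative integer or $n=-1$, and let $a,b$ be complex numbers such that $(a)_n\neq 0$ and $a-b$ is not zero or a negative integer. Then $$ {}_2F_1\!\left(\left.{a+n,\;b \atop a-b}\right| -1\right)= P(n)\,\frac{\Gamma(a-b)\,\Gamma(\frac{a+1}{2})}{\Gamma(a)\,\Gamma(\frac{a+1}{2}-b)}+Q(n)\,\frac{\Gamma(a-b)\,\Gamma(\frac{a}{2})}{\Gamma(a)\,\Gamma(\frac{a}{2}-b)}, $$ where $$ P(n)=\frac{1}{2^{n+1}}\;{}_3F_2\!\left({-\frac{n}{2},\,-\frac{n+1}{2},\,\frac{a}{2}-b \atop \frac12,\;\frac a2}\right),\qquad Q(n)=\frac{n+1}{2^{n+1}}\;{}_3F_2\!\left({-\frac{n-1}{2},\,-\frac{n}{2},\,\frac{a+1}{2}-b \atop \frac32,\;\frac{a+1}{2}}\right). $$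
   Context: Notation: $(x)_k=x(x+1)\cdots(x+k-1)$ for $k\ge 0$, with $(x)_0=1$. For $n=-1$ the condition $(a)_n\ne 0$ is regarded as vacuous (since $(a)_{-1}=1/(a-1)$ never vanishes). ${}_2F_1\!\left(\left.{A,B\atop C}\right|z\right)$, for $C\notin\{0,-1,-2,\dots\}$, denotes the analytic continuation to $\mathbb{C}\setminus[1,\infty)$ of the hypergeometric series $\sum_{k\ge0}\frac{(A)_k(B)_k}{(C)_k\,k!}z^k$. ${}_3F_2\!\left({A,B,C\atop E,F}\right)$ denotes the hypergeometric series at argument $1$, $\sum_{k\ge 0}\frac{(A)_k(B)_k(C)_k}{(E)_k(F)_k\,k!}$. If an upper parameter is a non-positive integer $-m$, the series is terminating and is understood as the finite sum over $0\le k\le m$. Thus in $P(n)$ the sum runs over $0\le k\le \lfloor (n+1)/2\rfloor$, and in $Q(n)$ (for $n\ge 0$) over $0\le k\le\lfloor n/2\rfloor$. For $n=-1$ the prefactor $n+1$ vanishes and $Q(-1)$ is understood to be $0$. The Gamma quotients are understood by continuity in $a$: $\Gamma(\frac{a+1}{2})/\Gamma(a)=2^{1-a}\sqrt\pi/\Gamma(\frac a2)$ and $\Gamma(\frac a2)/\Gamma(a)=2^{1-a}\sqrt\pi/\Gamma(\frac{a+1}{2})$, which are entire functions of $a$; $1/\Gamma$ is taken to be $0$ at the poles of $\Gamma$. *)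

theory Defs
  imports "HOL-Complex_Analysis.Complex_Analysis"
begin

abbreviation cut_plane :: "complex set" where
  "cut_plane \<equiv> - (complex_of_real ` {1..})"

(* Analytic continuation of the hypergeometric series to the plane cut along [1, \<infinity>).
   Only meaningful if C is not a non-positive integer and z lies in the cut plane; the value is
   then unique by the lemma hyp2F1_eqI. *)
definition hyp2F1 :: "complex \<Rightarrow> complex \<Rightarrow> complex \<Rightarrow> complex \<Rightarrow> complex" where
  "hyp2F1 A B C z = (THE w. \<exists>f. f holomorphic_on cut_plane \<and>
     (\<forall>u\<in>ball 0 1. f u = eval_fps (fps_hypergeo [A, B] [C] 1) u) \<and> w = f z)"

(* The hypergeometric series at argument 1. If an upper parameter is -m for a natural number m,
   all terms with k > m are 0, also when a lower Pochhammer symbol vanishes there (as x / 0 = 0),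
   so that the series is the finite sum over k \<le> m. *)
definition hyp3F2 :: "complex \<Rightarrow> complex \<Rightarrow> complex \<Rightarrow> complex \<Rightarrow> complex \<Rightarrow> complex" where
  "hyp3F2 A B C E F = eval_fps (fps_hypergeo [A, B, C] [E, F] 1) 1"

(* For n = -1 the factor n + 1 makes Q_coeff 0, whatever the value of the 3F2. *)
definition P_coeff :: "int \<Rightarrow> complex \<Rightarrow> complex \<Rightarrow> complex" where
  "P_coeff n a b = 1 / 2 powi (n + 1) *
     hyp3F2 (- (of_int n / 2)) (- ((of_int n + 1) / 2)) (a / 2 - b) (1 / 2) (a / 2)"

definition Q_coeff :: "int \<Rightarrow> complex \<Rightarrow> complex \<Rightarrow> complex" where
  "Q_coeff n a b = (of_int n + 1) / 2 powi (n + 1) *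
     hyp3F2 (- ((of_int n - 1) / 2)) (- (of_int n / 2)) ((a + 1) / 2 - b) (3 / 2) ((a + 1) / 2)"

(* The quotients \<Gamma>((a+1)/2) / \<Gamma>(a) and \<Gamma>(a/2) / \<Gamma>(a), extended by continuity to the a where a
   Gamma factor has a pole (there Gamma a = 0 and the bare quotient is always 0, as x / 0 = 0). *)
definition Gamma_quot1 :: "complex \<Rightarrow> complex" where
  "Gamma_quot1 = remove_sings (\<lambda>a. Gamma ((a + 1) / 2) / Gamma a)"

definition Gamma_quot2 :: "complex \<Rightarrow> complex" where
  "Gamma_quot2 = remove_sings (\<lambda>a. Gamma (a / 2) / Gamma a)"

lemma open_connected_cut_plane: "open cut_plane" "connected cut_plane"
proof -
  have cl: "closed (complex_of_real ` {1..})"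
    using closed_injective_linear_image[of "{1..}" complex_of_real]
    by (auto simp: inj_on_def bounded_linear.linear[OF bounded_linear_of_real])
  then show "open cut_plane" by auto
  have "starlike cut_plane"
    unfolding starlike_def
  proof (intro bexI[of _ 0] ballI subsetI)
    fix x y assume x: "x \<in> cut_plane" and y: "y \<in> closed_segment 0 x"
    then obtain u where u: "0 \<le> u" "u \<le> 1" "y = of_real u * x"
      by (auto simp: closed_segment_def scaleR_conv_of_real)
    show "y \<in> cut_plane"
    proof (rule ccontr)
      assume "y \<notin> cut_plane"
      then obtain r where r: "y = of_real r" "r \<ge> 1" by auto
      then have "u > 0" using u by (cases "u = 0") auto
      then have "x = of_real (r / u)" using u r by (simp add: field_simps)
      moreover have "r / u \<ge> 1" using u r \<open>u > 0\<close> by simp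
      ultimately show False using x by blast
    qed
  qed auto
  then show "connected cut_plane" by (rule starlike_imp_connected)
qed

lemma hyp2F1_eqI:
  assumes "f holomorphic_on cut_plane" "z \<in> cut_plane"
    and "\<And>u. u \<in> ball 0 1 \<Longrightarrow> f u = eval_fps (fps_hypergeo [A, B] [C] 1) u"
  shows "hyp2F1 A B C z = f z"
  unfolding hyp2F1_def
proof (rule the_equality)
  fix w
  assume "\<exists>f. f holomorphic_on cut_plane \<and>
     (\<forall>u\<in>ball 0 1. f u = eval_fps (fps_hypergeo [A, B] [C] 1) u) \<and> w = f z"
  then obtain g where g: "g holomorphic_on cut_plane" "w = g z"
    "\<And>u. u \<in> ball 0 1 \<Longrightarrow> g u = eval_fps (fps_hypergeo [A, B] [C] 1) u" by blast
  have sub: "ball 0 1 \<subseteq> cut_plane" by auto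
  show "w = f z"
    unfolding g(2)
    by (rule analytic_continuation_open[OF _ _ _ _ sub g(1) assms(1) _ assms(2)])
       (use open_connected_cut_plane g(3) assms(3) in auto)
qed (use assms in blast)

lemma Gamma_duplication_aux:
  fixes x :: complex
  assumes "x \<notin> \<int>"
  shows "Gamma (x / 2) * Gamma ((x + 1) / 2) = 2 powr (1 - x) * of_real (sqrt pi) * Gamma x"
proof -
  have "x / 2 \<notin> \<int>\<^sub>\<le>\<^sub>0" "x / 2 + 1 / 2 \<notin> \<int>\<^sub>\<le>\<^sub>0"
  proof -
    show "x / 2 \<notin> \<int>\<^sub>\<le>\<^sub>0"
    proof
      assume "x / 2 \<in> \<int>\<^sub>\<le>\<^sub>0"
      then have "2 * (x / 2) \<in> \<int>" by (intro Ints_mult) (auto dest: nonpos_Ints_Int)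
      then show False using assms by simp
    qed
    show "x / 2 + 1 / 2 \<notin> \<int>\<^sub>\<le>\<^sub>0"
    proof
      assume "x / 2 + 1 / 2 \<in> \<int>\<^sub>\<le>\<^sub>0"
      then have "2 * (x / 2 + 1 / 2) - 1 \<in> \<int>"
        by (intro Ints_mult Ints_diff) (auto dest: nonpos_Ints_Int)
      then show False using assms by (simp add: algebra_simps)
    qed
  qed
  from Gamma_legendre_duplication[OF this] show ?thesis
    by (simp add: powr_def add_divide_distrib flip: Ln_of_real)
qed

lemma eventually_not_Ints_at: "eventually (\<lambda>x. x \<notin> \<int>) (at (a :: complex))"
proof -
  have "closed (\<int> - {a})" by (rule closed_subset_Ints) auto
  then have "eventually (\<lambda>x. x \<in> - (\<int> - {a})) (at a)"
    by (intro eventually_at_in_open') (simp_all only: open_Compl, simp)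
  then show ?thesis
    using eventually_neq_at_within[of a a UNIV] by eventually_elim auto
qed

lemma Gamma_quot1_eq: "Gamma_quot1 a = 2 powr (1 - a) * of_real (sqrt pi) * rGamma (a / 2)"
  unfolding Gamma_quot1_def
proof (rule remove_sings_eqI, rule Lim_transform_eventually)
  show "((\<lambda>x. 2 powr (1 - x) * of_real (sqrt pi) * rGamma (x / 2)) \<longlongrightarrow>
          2 powr (1 - a) * of_real (sqrt pi) * rGamma (a / 2)) (at a)"
    by (intro tendsto_intros isCont_tendsto_compose[OF isCont_rGamma[OF continuous_ident]]) auto
  show "eventually (\<lambda>x. 2 powr (1 - x) * of_real (sqrt pi) * rGamma (x / 2) =
          Gamma ((x + 1) / 2) / Gamma x) (at a)"
    using eventually_not_Ints_at
  proof eventually_elim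
    case (elim x)
    have "x / 2 \<notin> \<int>" using Ints_mult[of 2 "x / 2"] elim by auto
    then have "Gamma x \<noteq> 0" "Gamma (x / 2) \<noteq> 0"
      using elim by (auto simp: Gamma_eq_zero_iff dest: nonpos_Ints_Int)
    then show ?case using Gamma_duplication_aux[OF elim]
      by (simp add: rGamma_inverse_Gamma field_simps)
  qed
qed

lemma Gamma_quot2_eq: "Gamma_quot2 a = 2 powr (1 - a) * of_real (sqrt pi) * rGamma ((a + 1) / 2)"
  unfolding Gamma_quot2_def
proof (rule remove_sings_eqI, rule Lim_transform_eventually)
  show "((\<lambda>x. 2 powr (1 - x) * of_real (sqrt pi) * rGamma ((x + 1) / 2)) \<longlongrightarrow>
          2 powr (1 - a) * of_real (sqrt pi) * rGamma ((a + 1) / 2)) (at a)"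
    by (intro tendsto_intros isCont_tendsto_compose[OF isCont_rGamma[OF continuous_ident]]) auto
  show "eventually (\<lambda>x. 2 powr (1 - x) * of_real (sqrt pi) * rGamma ((x + 1) / 2) =
          Gamma (x / 2) / Gamma x) (at a)"
    using eventually_not_Ints_at
  proof eventually_elim
    case (elim x)
    have "(x + 1) / 2 \<notin> \<int>"
    proof
      assume "(x + 1) / 2 \<in> \<int>"
      then have "2 * ((x + 1) / 2) - 1 \<in> \<int>" by (intro Ints_mult Ints_diff) auto
      moreover have "2 * ((x + 1) / 2) - 1 = x" by (simp add: field_simps)
      ultimately show False using elim by (simp only:)
    qed
    then have "Gamma x \<noteq> 0" "Gamma ((x + 1) / 2) \<noteq> 0"
      using elim by (auto simp: Gamma_eq_zero_iff dest: nonpos_Ints_Int)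
    then show ?case using Gamma_duplication_aux[OF elim]
      by (simp add: rGamma_inverse_Gamma field_simps)
  qed
qed

end

theory Submission
  imports Defs
begin

text \<open>
  Averaging with the contiguous relation
  \<open>2 F(A+1,b;c;-1) = F(A,b;c;-1) + (c-b)/c F(A+1,b;c+1;-1)\<close>
  (in Euler's integral: \<open>1/(1+t) = (1 + (1-t)/(1+t))/2\<close>) \<open>n+1\<close> times reduces the claim to a binomial
  sum over \<open>j \<le> n+1\<close> of the values \<open>F(a+j-1,b;a+j-b;-1)\<close>, which Kummer's theorem evaluates. The even
  \<open>j\<close> add up to the first summand, the odd \<open>j\<close> to the second one. Kummer's theorem itself is proved
  on the other side of Pfaff's transformation, where \<open>-1\<close> becomes \<open>1/2\<close>.
\<close>

section \<open>Analytic continuation to the cut plane\<close>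

text \<open>The point -1 lies on the circle of convergence, where the series need not converge, and
  \<open>hyp2F1\<close> is a definite description: nothing can be said about its value until a
  continuation is known to exist. Euler's integral provides one for parameters with large real
  parts, and two identities between a series and the derivative of another bring it down to all
  parameters. Pfaff's transformation then turns every value at -1 into an absolutely convergent
  series at 1/2, where both the contiguous relation and Kummer's theorem are statements about
  coefficients. The induction starts at n = -1 because there the transformed upper parameters are 1
  - b and b: they do not involve a, and a recurrence in the lower parameter alone determines the
  sum. Working with \<open>rGamma\<close>, which is entire, keeps the poles of the Gamma function in
  a out of the argument. The condition on (a)_n is what permits division by the Pochhammer symbols
  of a/2 and (a+1)/2 in the nonzero terms of the binomial sum.\<close>

lemma add_of_nat_neq_0:
  assumes "c \<notin> \<int>\<^sub>\<le>\<^sub>0"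
  shows "c + of_nat n \<noteq> (0 :: complex)"
  using assms plus_of_nat_eq_0_imp by blast

lemma pochhammer_neq_0:
  assumes "c \<notin> \<int>\<^sub>\<le>\<^sub>0"
  shows "pochhammer c n \<noteq> (0 :: complex)"
  using assms by (auto simp: pochhammer_eq_0_iff)

lemma add_of_nat_notin_nonpos_Ints:
  assumes "c \<notin> \<int>\<^sub>\<le>\<^sub>0"
  shows "c + of_nat n \<notin> (\<int>\<^sub>\<le>\<^sub>0 :: complex set)"
proof
  assume "c + of_nat n \<in> \<int>\<^sub>\<le>\<^sub>0"
  then obtain m where "c + of_nat n = - of_nat m"
    by (elim nonpos_Ints_cases')
  then have "c = of_int (- int (m + n))"
    by (simp add: algebra_simps)
  then have "c \<in> \<int>\<^sub>\<le>\<^sub>0"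
    by (metis nonpos_Ints_of_int neg_le_0_iff_le of_nat_0_le_iff)
  with assms show False by simp
qed

lemma pochhammer_shift: "c * pochhammer (c + 1) k = (c + of_nat k) * pochhammer c k"
  for c :: "'a :: comm_ring_1"
  by (metis pochhammer_rec pochhammer_rec')

section \<open>Coefficients and radius of convergence of the Gauss series\<close>

lemma hypergeo_2_1_nth:
  "fps_nth (fps_hypergeo [A, B] [C] 1) k = pochhammer A k * pochhammer B k / (pochhammer C k * fact k)"
  for A B C :: "'a :: field_char_0"
  by simp

lemma ratio_tendsto_1: "(\<lambda>k. (A + of_nat k) / (C + of_nat k)) \<longlonglongrightarrow> (1 :: complex)"
proof -
  have "(\<lambda>k. (A / of_nat k + 1) / (C / of_nat k + 1)) \<longlonglongrightarrow> (0 + 1) / (0 + 1)"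
    by (intro tendsto_intros lim_const_over_n) auto
  moreover have "eventually (\<lambda>k. (A / of_nat k + 1) / (C / of_nat k + 1) = (A + of_nat k) / (C + of_nat k)) sequentially"
    using eventually_gt_at_top[of 0]
    by eventually_elim (simp add: divide_simps)
  ultimately show ?thesis
    by (simp add: tendsto_cong)
qed

lemma summable_hypergeo_2_1:
  fixes A B C :: complex
  assumes "norm z < 1"
  shows "summable (\<lambda>k. norm (fps_nth (fps_hypergeo [A, B] [C] 1) k * z ^ k))"
proof -
  define c where "c = (1 + norm z) / 2"
  have c: "norm z < c" "c < 1" using assms by (auto simp: c_def)
  define t where "t = (\<lambda>k. fps_nth (fps_hypergeo [A, B] [C] 1) k * z ^ k)"
  have "(\<lambda>k. norm ((A + of_nat k) / (C + of_nat k) * ((B + of_nat k) / (1 + of_nat k)) * z)) \<longlonglongrightarrow> norm (1 * 1 * z)"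
    by (intro tendsto_intros ratio_tendsto_1)
  then have "eventually (\<lambda>k. norm ((A + of_nat k) / (C + of_nat k) * ((B + of_nat k) / (1 + of_nat k)) * z) < c) sequentially"
    using c by (intro order_tendstoD(2)) auto
  then obtain N where N: "\<And>k. k \<ge> N \<Longrightarrow> norm ((A + of_nat k) / (C + of_nat k) * ((B + of_nat k) / (1 + of_nat k)) * z) < c"
    by (auto simp: eventually_at_top_linorder)
  \<comment> \<open>This also holds if C + k = 0, both sides then being 0 because x / 0 = 0.\<close>
  have rec: "t (Suc k) = (A + of_nat k) / (C + of_nat k) * ((B + of_nat k) / (1 + of_nat k)) * z * t k" for k
    by (simp add: t_def pochhammer_Suc mult_ac)
  have "summable (\<lambda>k. norm (t k))"
  proof (rule summable_ratio_test[OF c(2)])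
    fix k assume "k \<ge> N"
    show "norm (norm (t (Suc k))) \<le> c * norm (norm (t k))"
      unfolding rec norm_mult[of _ "t k"] using N[OF \<open>k \<ge> N\<close>]
      by (simp add: mult_right_mono)
  qed
  then show ?thesis by (simp add: t_def)
qed

lemma fps_conv_radius_hypergeo_2_1: "fps_conv_radius (fps_hypergeo [A, B] [C] (1 :: complex)) \<ge> 1"
  unfolding fps_conv_radius_def
proof (rule conv_radius_geI_ex)
  fix r :: real assume "0 < r" "ereal r < 1"
  then show "\<exists>z. norm z = r \<and> summable (\<lambda>n. fps_nth (fps_hypergeo [A, B] [C] (1 :: complex)) n * z ^ n)"
    by (intro exI[of _ "of_real r"] conjI summable_norm_cancel[OF summable_hypergeo_2_1]) auto
qed

lemma norm_less_conv_radius_hypergeo_2_1: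
  "norm z < 1 \<Longrightarrow> ereal (norm (z :: complex)) < fps_conv_radius (fps_hypergeo [A, B] [C] (1 :: complex))"
  using fps_conv_radius_hypergeo_2_1[of A B C] by (metis ereal_less(3) le_less_trans less_le_not_le linorder_not_less one_ereal_def less_ereal.simps(1))

text \<open>The existence half behind the definite description in \<open>hyp2F1\<close>; the
  uniqueness half is \<open>hyp2F1_eqI\<close>.\<close>

definition continuable :: "complex \<Rightarrow> complex \<Rightarrow> complex \<Rightarrow> bool" where
  "continuable A B C \<longleftrightarrow> (\<exists>f. f holomorphic_on cut_plane \<and>
     (\<forall>u\<in>ball 0 1. f u = eval_fps (fps_hypergeo [A, B] [C] 1) u))"

text \<open>Since 1/(C)_k = (1 + k/C) / (C+1)_k, the series for C is F + z F'/C, where F is the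
  series for C + 1. The same combination of a continuation of F and its derivative is holomorphic on
  the cut plane.\<close>

lemma continuable_decrease_C:
  assumes "continuable A B (C + 1)" "C \<notin> \<int>\<^sub>\<le>\<^sub>0"
  shows "continuable A B C"
proof -
  define F where "F = fps_hypergeo [A, B] [C + 1] (1 :: complex)"
  obtain f where f: "f holomorphic_on cut_plane" "\<And>u. u \<in> ball 0 1 \<Longrightarrow> f u = eval_fps F u"
    using assms(1) unfolding continuable_def F_def by blast
  have [simp]: "C \<noteq> 0" using assms(2) by auto
  have F_eq: "fps_hypergeo [A, B] [C] 1 = F + fps_const (1 / C) * (fps_X * fps_deriv F)"
  proof (rule fps_ext)
    fix k
    have nz: "pochhammer (C + 1) k \<noteq> 0" "pochhammer C k \<noteq> 0"
      using assms(2) add_of_nat_notin_nonpos_Ints[OF assms(2), of 1] by (auto intro!: pochhammer_neq_0)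
    have "pochhammer (C + 1) k = (C + of_nat k) * pochhammer C k / C"
      by (simp add: pochhammer_shift flip: pochhammer_shift)
    moreover have "C + of_nat k \<noteq> 0"
      using assms(2) by (rule add_of_nat_neq_0)
    ultimately have "fps_nth (fps_hypergeo [A, B] [C] 1) k = fps_nth F k + 1 / C * (of_nat k * fps_nth F k)"
      using nz unfolding F_def hypergeo_2_1_nth by (simp add: divide_simps) (simp add: algebra_simps)
    also have "of_nat k * fps_nth F k = fps_nth (fps_X * fps_deriv F) k"
      by (cases k) auto
    finally show "fps_nth (fps_hypergeo [A, B] [C] 1) k = fps_nth (F + fps_const (1 / C) * (fps_X * fps_deriv F)) k"
      by simp
  qed
  show ?thesis
    unfolding continuable_def
  proof (intro exI conjI ballI)
    show "(\<lambda>z. f z + 1 / C * (z * deriv f z)) holomorphic_on cut_plane"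
      using f(1) open_connected_cut_plane by (intro holomorphic_intros) auto
    fix u :: complex assume u: "u \<in> ball 0 1"
    have F: "ereal (norm u) < fps_conv_radius F"
      unfolding F_def using u by (intro norm_less_conv_radius_hypergeo_2_1) auto
    have F': "ereal (norm u) < fps_conv_radius (fps_deriv F)"
      using F fps_conv_radius_deriv[of F] by simp
    have XF': "ereal (norm u) < fps_conv_radius (fps_X * fps_deriv F)"
      using fps_conv_radius_mult[of fps_X "fps_deriv F"] F' by (simp add: less_le_trans)
    have CXF': "ereal (norm u) < fps_conv_radius (fps_const (1 / C) * (fps_X * fps_deriv F))"
      using fps_conv_radius_mult[of "fps_const (1 / C)" "fps_X * fps_deriv F"] XF' by (simp add: less_le_trans)
    have "eventually (\<lambda>v. v \<in> ball 0 1) (nhds u)"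
      using u by (intro eventually_nhds_in_open) auto
    then have "eventually (\<lambda>v. f v = eval_fps F v) (nhds u)"
      by eventually_elim (use f(2) in auto)
    then have "deriv f u = deriv (eval_fps F) u"
      by (intro deriv_cong_ev) auto
    also have "\<dots> = eval_fps (fps_deriv F) u"
      using F by (simp add: eval_fps_deriv)
    finally show "f u + 1 / C * (u * deriv f u) = eval_fps (fps_hypergeo [A, B] [C] 1) u"
      using f(2)[OF u] F F' XF' CXF' by (simp add: F_eq eval_fps_add eval_fps_mult)
  qed
qed

text \<open>Gives primitives of holomorphic functions on the cut plane, which is not convex.\<close>

lemma starlike_cut_plane: "starlike cut_plane"
  unfolding starlike_def
proof (intro bexI[of _ 0] ballI subsetI)
  fix x y assume x: "x \<in> cut_plane" and y: "y \<in> closed_segment 0 x"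
  then obtain u where u: "0 \<le> u" "u \<le> 1" "y = of_real u * x"
    by (auto simp: closed_segment_def scaleR_conv_of_real)
  show "y \<in> cut_plane"
  proof (rule ccontr)
    assume "y \<notin> cut_plane"
    then obtain r where r: "y = of_real r" "r \<ge> 1" by auto
    then have "u > 0" using u by (cases "u = 0") auto
    then have "x = of_real (r / u)" using u r by (simp add: field_simps)
    moreover have "r / u \<ge> 1" using u r \<open>u > 0\<close> by simp
    ultimately show False using x by blast
  qed
qed auto

text \<open>The derivative of F(A,B;C;z) is AB/C F(A+1,B+1;C+1;z), so a primitive of the given
  continuation, scaled and normalised to 1 at 0, continues F(A,B;C;z).\<close>

lemma continuable_decrease_all:
  assumes "continuable (A + 1) (B + 1) (C + 1)" "C \<notin> \<int>\<^sub>\<le>\<^sub>0"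
  shows "continuable A B C"
proof -
  define F where "F = fps_hypergeo [A, B] [C] (1 :: complex)"
  define G where "G = fps_hypergeo [A + 1, B + 1] [C + 1] (1 :: complex)"
  obtain f where f: "f holomorphic_on cut_plane" "\<And>u. u \<in> ball 0 1 \<Longrightarrow> f u = eval_fps G u"
    using assms(1) unfolding continuable_def G_def by blast
  have deriv_F: "fps_deriv F = fps_const (A * B / C) * G"
  proof (rule fps_ext)
    fix k
    have "fact k + fact k * of_nat k \<noteq> (0 :: complex)"
      using fact_nonzero[of "Suc k", where 'a = complex] by (simp add: algebra_simps)
    then show "fps_nth (fps_deriv F) k = fps_nth (fps_const (A * B / C) * G) k"
      by (simp add: F_def G_def pochhammer_rec divide_simps) (simp add: algebra_simps)
  qed
  have "\<exists>g. \<forall>z\<in>cut_plane. (g has_field_derivative f z) (at z)"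
    using f(1) open_connected_cut_plane(1) starlike_cut_plane
    by (intro holomorphic_starlike_primitive[where k = "{}"] holomorphic_on_imp_continuous_on)
       (auto simp: holomorphic_on_open field_differentiable_def)
  then obtain g where g: "\<And>z. z \<in> cut_plane \<Longrightarrow> (g has_field_derivative f z) (at z)"
    by blast
  define h where "h = (\<lambda>z. 1 + A * B / C * (g z - g 0))"
  have h: "(h has_field_derivative (A * B / C * f z)) (at z)" if "z \<in> cut_plane" for z
    unfolding h_def using g[OF that] assms(2) by (auto intro!: derivative_eq_intros)
  have h_holo: "h holomorphic_on cut_plane"
    using h open_connected_cut_plane by (auto simp: holomorphic_on_open)
  show ?thesis
    unfolding continuable_def
  proof (intro exI conjI ballI)
    show "h holomorphic_on cut_plane"
      by (rule h_holo)
    fix u :: complex assume u: "u \<in> ball 0 1"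
    have "((\<lambda>v. h v - eval_fps F v) has_field_derivative 0) (at v)" if v: "v \<in> ball 0 1" for v
    proof -
      have cv: "ereal (norm v) < fps_conv_radius F" "ereal (norm v) < fps_conv_radius G"
        unfolding F_def G_def using v by (auto intro!: norm_less_conv_radius_hypergeo_2_1)
      have "v \<in> cut_plane" using v by auto
      moreover have "(eval_fps F has_field_derivative eval_fps (fps_deriv F) v) (at v)"
        using cv by (intro has_field_derivative_eval_fps) auto
      moreover have "eval_fps (fps_deriv F) v = A * B / C * f v"
        using cv f(2)[OF v] by (simp add: deriv_F eval_fps_mult)
      ultimately have "((\<lambda>v. h v - eval_fps F v) has_field_derivative
          A * B / C * f v - eval_fps (fps_deriv F) v) (at v)"
        by (intro DERIV_diff h)
      with \<open>eval_fps (fps_deriv F) v = A * B / C * f v\<close> show ?thesis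
        by simp
    qed
    then have "\<exists>c. \<forall>v\<in>ball 0 1. h v - eval_fps F v = c"
      by (intro has_field_derivative_zero_constant) (auto intro: has_field_derivative_at_within)
    then have "h u - eval_fps F u = h 0 - eval_fps F 0"
      using u by force
    then show "h u = eval_fps (fps_hypergeo [A, B] [C] 1) u"
      by (simp add: h_def F_def eval_fps_at_0)
  qed
qed

text \<open>By Weierstrass, f is a uniform limit of polynomials p, and each integral of p f
  vanishes; hence so does the integral of f^2. This shows later that the normalising constant of
  Euler's integral is not 0, without evaluating it.\<close>

lemma zero_moments_imp_zero:
  fixes f :: "real \<Rightarrow> real"
  assumes cont: "continuous_on {0..1} f"
    and mom: "\<And>k. ((\<lambda>t. t ^ k * f t) has_integral 0) {0..1}"
    and x: "x \<in> {0..1}"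
  shows "f x = 0"
proof -
  \<comment> \<open>Moments in the shape of the Bernstein basis, which is the form of the
    approximating polynomials below.\<close>
  have mom': "((\<lambda>t. t ^ k * (1 - t) ^ m * f t) has_integral 0) {0..1}" for k m
  proof (induction m arbitrary: k)
    case 0
    then show ?case using mom by simp
  next
    case (Suc m)
    have "((\<lambda>t. t ^ k * (1 - t) ^ m * f t - t ^ Suc k * (1 - t) ^ m * f t) has_integral 0 - 0) {0..1}"
      by (intro has_integral_diff Suc)
    then show ?case by (simp add: algebra_simps)
  qed
  define b where "b = (\<lambda>n t. (\<Sum>k\<le>n. f (real k / real n) * Bernstein n k t))"
  have cont_b: "continuous_on {0..1} (b n)" for n
    unfolding b_def Bernstein_def by (intro continuous_intros)
  have bi: "((\<lambda>t. b n t * f t) has_integral 0) {0..1}" for n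
  proof -
    have "((\<lambda>t. \<Sum>k\<le>n. f (real k / real n) * real (n choose k) * (t ^ k * (1 - t) ^ (n - k) * f t))
      has_integral (\<Sum>k\<le>n. f (real k / real n) * real (n choose k) * 0)) {0..1}"
      by (intro has_integral_sum has_integral_mult_right mom') auto
    then show ?thesis
      by (simp add: b_def Bernstein_def sum_distrib_right sum_distrib_left mult_ac)
  qed
  have "uniform_limit {0..1} b f sequentially"
  proof (rule uniform_limitI)
    fix e :: real assume "e > 0"
    from Bernstein_Weierstrass[OF cont this] obtain N
      where N: "\<And>n x. N \<le> n \<Longrightarrow> x \<in> {0..1} \<Longrightarrow> \<bar>f x - b n x\<bar> < e"
      unfolding b_def by blast
    then show "\<forall>\<^sub>F n in sequentially. \<forall>x\<in>{0..1}. dist (b n x) (f x) < e"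
      by (intro eventually_sequentiallyI[of N]) (auto simp: dist_real_def abs_minus_commute)
  qed
  moreover have "bounded (f ` {0..1})"
    by (intro compact_imp_bounded compact_continuous_image cont) auto
  ultimately have "uniform_limit {0..1} (\<lambda>n t. b n t * f t) (\<lambda>t. f t * f t) sequentially"
    by (intro uniform_limit_intros) auto
  then obtain I J where IJ: "\<And>n. ((\<lambda>t. b n t * f t) has_integral I n) {0..1}"
      "((\<lambda>t. f t * f t) has_integral J) {0..1}" "I \<longlonglongrightarrow> J"
    by (rule uniform_limit_integral) (use cont cont_b in \<open>auto intro!: continuous_intros\<close>)
  have "I = (\<lambda>_. 0)"
    using IJ(1) bi has_integral_unique by blast
  with IJ(3) have "J = 0"
    using LIMSEQ_unique tendsto_const by blast
  with IJ(2) have "f x * f x = 0"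
    using x cont by (intro has_integral_0_cbox_imp_0[of 0 1 "\<lambda>t. f t * f t"]) (auto intro!: continuous_intros)
  then show ?thesis by simp
qed

text \<open>Keeps the base of the power in Euler's integrand off the branch cut of
  \<open>powr\<close>, so that the integrand is holomorphic in z on the whole cut plane.\<close>

lemma one_minus_mult_notin_nonpos_Reals:
  assumes "z \<in> cut_plane" "t \<in> {0..1}"
  shows "1 - z * of_real t \<notin> \<real>\<^sub>\<le>\<^sub>0"
proof
  assume "1 - z * of_real t \<in> \<real>\<^sub>\<le>\<^sub>0"
  then obtain r where r: "1 - z * of_real t = of_real r" "r \<le> 0"
    by (auto simp: nonpos_Reals_def)
  then have "t \<noteq> 0" by auto
  with assms have "t > 0" by auto
  have "z = of_real ((1 - r) / t)"
    using r \<open>t \<noteq> 0\<close> by (simp add: field_simps)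
  moreover have "(1 - r) / t \<ge> 1"
    using r assms \<open>t > 0\<close> by simp
  ultimately show False using assms by blast
qed

text \<open>Euler's integral; normalised by its value at 0 instead of by the Beta function.\<close>

lemma continuable_Euler:
  assumes B: "Re B > 1" and CB: "Re (C - B) > 1"
  shows "continuable A B C"
proof -
  define g where "g = (\<lambda>t. of_real t powr (B - 1) * of_real (1 - t) powr (C - B - 1))"
  define m where "m = (\<lambda>k. integral {0..1} (\<lambda>t. of_real t ^ k * g t))"
  \<comment> \<open>Both exponents have positive real part, so g is continuous up to the endpoints
    and no improper integral occurs.\<close>
  have cont_g [continuous_intros]: "continuous_on {0..1} g"
    unfolding g_def using assms by (intro continuous_intros) auto
  have C: "C \<notin> \<int>\<^sub>\<le>\<^sub>0"
    using assms by (auto elim!: nonpos_Ints_cases')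
  have m: "((\<lambda>t. of_real t ^ k * g t) has_integral m k) {0..1}" for k
    unfolding m_def by (intro integrable_integral integrable_continuous_real continuous_intros)
  \<comment> \<open>Integrate the derivative of t^(B+k) (1-t)^(C-B), which vanishes at both
    endpoints; the derivative is ((B+k) - (C+k) t) t^k g(t).\<close>
  have m_rec: "(B + of_nat k) * m k = (C + of_nat k) * m (Suc k)" for k
  proof -
    define h where "h = (\<lambda>t. of_real t powr (B + of_nat k) * of_real (1 - t) powr (C - B))"
    have "((\<lambda>t. (B + of_nat k) * (of_real t ^ k * g t) - (C + of_nat k) * (of_real t ^ Suc k * g t))
      has_integral h 1 - h 0) {0..1}"
    proof (rule fundamental_theorem_of_calculus_interior)
      show "continuous_on {0..1} h"
        unfolding h_def using assms by (intro continuous_intros) auto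
      fix t :: real assume t: "t \<in> {0<..<1}"
      have "((\<lambda>z. z powr (B + of_nat k) * (1 - z) powr (C - B)) has_field_derivative
        ((B + of_nat k) * (of_real t ^ k * g t) - (C + of_nat k) * (of_real t ^ Suc k * g t))) (at (of_real t))"
        using t by (auto intro!: derivative_eq_intros simp: g_def powr_add powr_diff complex_nonpos_Reals_iff)
          (simp add: field_simps)
      then show "(h has_vector_derivative ((B + of_nat k) * (of_real t ^ k * g t) - (C + of_nat k) * (of_real t ^ Suc k * g t))) (at t)"
        unfolding h_def of_real_diff of_real_1
        by (rule has_vector_derivative_real_field)
    qed simp
    moreover have "h 0 = 0" "h 1 = 0" using assms by (auto simp: h_def)
    moreover have "((\<lambda>t. (B + of_nat k) * (of_real t ^ k * g t) - (C + of_nat k) * (of_real t ^ Suc k * g t))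
      has_integral (B + of_nat k) * m k - (C + of_nat k) * m (Suc k)) {0..1}"
      by (intro has_integral_diff has_integral_mult_right m)
    ultimately have "h 1 - h 0 = (B + of_nat k) * m k - (C + of_nat k) * m (Suc k)"
      using has_integral_unique by blast
    with \<open>h 0 = 0\<close> \<open>h 1 = 0\<close> show ?thesis
      by simp
  qed
  have m_eq: "m k = m 0 * pochhammer B k / pochhammer C k" for k
  proof (induction k)
    case (Suc k)
    have "m (Suc k) = (B + of_nat k) * m k / (C + of_nat k)"
      using m_rec[of k] add_of_nat_neq_0[OF C, of k] by (simp add: field_simps)
    then show ?case using Suc by (simp add: pochhammer_Suc)
  qed auto
  \<comment> \<open>All moments are multiples of the zeroth one. If that were 0, the real and
    imaginary parts of g would vanish identically, but g(1/2) is a product of nonzero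
    powers.\<close>
  have "m 0 \<noteq> 0"
  proof
    assume "m 0 = 0"
    then have m0: "((\<lambda>t. of_real t ^ k * g t) has_integral 0) {0..1}" for k
      using m[of k] m_eq[of k] by simp
    have eq: "Re (of_real t ^ k * g t) = t ^ k * Re (g t)" "Im (of_real t ^ k * g t) = t ^ k * Im (g t)" for t k
      by (simp_all flip: of_real_power)
    have "Re (g (1 / 2)) = 0"
      using has_integral_Re[OF m0] unfolding eq
      by (intro zero_moments_imp_zero[where f = "\<lambda>t. Re (g t)"]) (auto intro!: continuous_intros)
    moreover have "Im (g (1 / 2)) = 0"
      using has_integral_Im[OF m0] unfolding eq
      by (intro zero_moments_imp_zero[where f = "\<lambda>t. Im (g t)"]) (auto intro!: continuous_intros)
    ultimately have "g (1 / 2) = 0" by (simp add: complex_eq_iff)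
    then show False by (simp add: g_def)
  qed
  define I where "I = (\<lambda>z. integral (cbox 0 1) (\<lambda>t. g t * (1 - z * of_real t) powr (-A)))"
  have cont_powr: "continuous_on (S \<times> {0..1}) (\<lambda>(z, t). (1 - z * of_real t) powr a)"
    if "S \<subseteq> cut_plane" for S a
    unfolding case_prod_unfold
  proof (intro continuous_intros subsetI)
    fix p assume p: "p \<in> S \<times> {0..1 :: real}"
    then have *: "1 - fst p * of_real (snd p) \<notin> \<real>\<^sub>\<le>\<^sub>0"
      using that by (intro one_minus_mult_notin_nonpos_Reals) auto
    then show "p \<in> {p. 0 \<le> Re (1 - fst p * of_real (snd p)) \<or> Im (1 - fst p * of_real (snd p)) \<noteq> 0}"
      by (auto simp: complex_nonpos_Reals_iff)
    show "0 < Re a" if "1 - fst p * of_real (snd p) = 0"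
      using * that by simp
  qed
  have cont_powr1: "continuous_on {0..1} (\<lambda>t. (1 - z * of_real t) powr a)" if "z \<in> cut_plane" for z a
  proof -
    have "continuous_on {0..1} (\<lambda>t. case (z, t) of (z, t) \<Rightarrow> (1 - z * of_real t) powr a)"
      by (rule continuous_on_compose2[OF cont_powr[of "{z}" a]]) (use that in \<open>auto intro!: continuous_intros\<close>)
    then show ?thesis by simp
  qed
  \<comment> \<open>Differentiation under the integral sign is applied on balls, since it asks for a
    convex domain.\<close>
  have "I analytic_on cut_plane"
    unfolding analytic_on_def
  proof
    fix z assume "z \<in> cut_plane"
    then obtain e where e: "e > 0" "ball z e \<subseteq> cut_plane"
      using open_connected_cut_plane(1) open_contains_ball by blast
    have "I holomorphic_on ball z e"
      unfolding I_def
    proof (rule leibniz_rule_holomorphic[where fx = "\<lambda>w t. A * g t * of_real t * (1 - w * of_real t) powr (- A - 1)"])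
      fix w t assume w: "w \<in> ball z e" and t: "t \<in> cbox 0 (1 :: real)"
      then have "1 - w * of_real t \<notin> \<real>\<^sub>\<le>\<^sub>0"
        using e by (intro one_minus_mult_notin_nonpos_Reals) auto
      then show "((\<lambda>w. g t * (1 - w * of_real t) powr - A) has_field_derivative
          A * g t * of_real t * (1 - w * of_real t) powr (- A - 1)) (at w within ball z e)"
        by (auto intro!: derivative_eq_intros)
    next
      fix w assume "w \<in> ball z e"
      then show "(\<lambda>t. g t * (1 - w * of_real t) powr - A) integrable_on cbox 0 1"
        unfolding cbox_interval using e
        by (intro integrable_continuous_real continuous_intros cont_powr1) auto
    next
      have "continuous_on (ball z e \<times> {0..1 :: real}) (\<lambda>p. A * g (snd p) * of_real (snd p) * (case p of (w, t) \<Rightarrow> (1 - w * of_real t) powr (- A - 1)))"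
        by (intro continuous_intros cont_powr e continuous_on_compose2[OF cont_g]) auto
      then show "continuous_on (ball z e \<times> cbox 0 1) (\<lambda>(w, t). A * g t * of_real t * (1 - w * of_real t) powr (- A - 1))"
        by (simp add: case_prod_unfold)
    qed auto
    with e show "\<exists>e>0. I holomorphic_on ball z e" by blast
  qed
  then have hol: "I holomorphic_on cut_plane" by (rule analytic_imp_holomorphic)
  \<comment> \<open>Expand the power of 1 - ut in its binomial series, which converges uniformly for
    t in [0,1], and integrate term by term: the moments supply the factors (B)_k/(C)_k.\<close>
  have I_eq: "I u = m 0 * eval_fps (fps_hypergeo [A, B] [C] 1) u" if u: "u \<in> ball 0 1" for u
  proof -
    define c where "c = (\<lambda>k. pochhammer A k / fact k * u ^ k)"
    have c: "(\<lambda>k. c k * of_real t ^ k) sums (1 - u * of_real t) powr (-A)" if "t \<in> {0..1}" for t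
    proof -
      have "norm u * \<bar>t\<bar> \<le> norm u * 1"
        using that by (intro mult_left_mono) auto
      then have "norm (- (u * of_real t)) < 1"
        using u by (simp add: norm_mult)
      from gen_binomial_complex[OF this, of "-A"] have "(\<lambda>k. ((- A) gchoose k) * (- (u * of_real t)) ^ k) sums (1 - u * of_real t) powr (-A)"
        by simp
      also have "(\<lambda>k. ((- A) gchoose k) * (- (u * of_real t)) ^ k) = (\<lambda>k. c k * of_real t ^ k)"
        by (simp add: fun_eq_iff c_def gbinomial_pochhammer power_minus[of "u * _"] power_mult_distrib
            flip: power_add mult_2)
      finally show ?thesis .
    qed
    \<comment> \<open>The binomial series is the Gauss series with second and lower parameter
      1.\<close>
    have "summable (\<lambda>k. norm (c k))"
      using summable_hypergeo_2_1[of u A 1 1] u by (simp add: c_def pochhammer_fact[symmetric])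
    have "bounded (g ` {0..1})"
      by (intro compact_imp_bounded compact_continuous_image cont_g) auto
    then obtain M where M: "\<And>t. t \<in> {0..1} \<Longrightarrow> norm (g t) \<le> M"
      unfolding bounded_iff by blast
    have "M \<ge> 0" using order.trans[OF norm_ge_zero M[of 0]] by simp
    have "uniform_limit {0..1} (\<lambda>n t. \<Sum>k<n. g t * (c k * of_real t ^ k)) (\<lambda>t. \<Sum>k. g t * (c k * of_real t ^ k)) sequentially"
    proof (rule Weierstrass_m_test)
      fix k and t :: real assume t: "t \<in> {0..1}"
      then have "norm (of_real t ^ k :: complex) \<le> 1"
        by (simp add: norm_power power_le_one)
      then have "norm (g t) * (norm (c k) * norm (of_real t ^ k :: complex)) \<le> M * (norm (c k) * 1)"
        using M[OF t] \<open>M \<ge> 0\<close> by (intro mult_mono mult_left_mono) auto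
      then show "norm (g t * (c k * of_real t ^ k)) \<le> M * norm (c k)"
        by (simp add: norm_mult)
    next
      show "summable (\<lambda>k. M * norm (c k))"
        by (rule summable_mult) fact
    qed
    also have "?this \<longleftrightarrow> uniform_limit {0..1} (\<lambda>n t. \<Sum>k<n. g t * (c k * of_real t ^ k)) (\<lambda>t. g t * (1 - u * of_real t) powr (-A)) sequentially"
      using sums_unique[OF sums_mult[OF c]] by (intro uniform_limit_cong) auto
    finally obtain J K where JK: "\<And>n. ((\<lambda>t. \<Sum>k<n. g t * (c k * of_real t ^ k)) has_integral J n) {0..1}"
      "((\<lambda>t. g t * (1 - u * of_real t) powr (-A)) has_integral K) {0..1}" "J \<longlonglongrightarrow> K"
      by (rule uniform_limit_integral) (auto intro!: continuous_intros)
    have "((\<lambda>t. \<Sum>k<n. g t * (c k * of_real t ^ k)) has_integral (\<Sum>k<n. c k * m k)) {0..1}" for n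
    proof -
      have "((\<lambda>t. \<Sum>k<n. c k * (of_real t ^ k * g t)) has_integral (\<Sum>k<n. c k * m k)) {0..1}"
        by (intro has_integral_sum has_integral_mult_right m) auto
      then show ?thesis by (simp add: mult_ac)
    qed
    then have "J = (\<lambda>n. \<Sum>k<n. c k * m k)"
      using JK(1) has_integral_unique by blast
    then have "(\<lambda>k. c k * m k) sums K"
      using JK(3) by (simp add: sums_def)
    moreover have "c k * m k = m 0 * (fps_nth (fps_hypergeo [A, B] [C] 1) k * u ^ k)" for k
      by (subst m_eq) (simp add: c_def mult_ac)
    moreover have "I u = K"
      unfolding I_def cbox_interval using JK(2) by (rule integral_unique)
    ultimately have "(\<lambda>k. m 0 * (fps_nth (fps_hypergeo [A, B] [C] 1) k * u ^ k)) sums I u" by simp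
    moreover have "(\<lambda>k. m 0 * (fps_nth (fps_hypergeo [A, B] [C] 1) k * u ^ k)) sums (m 0 * eval_fps (fps_hypergeo [A, B] [C] 1) u)"
      unfolding eval_fps_def using u
      by (intro sums_mult summable_sums summable_norm_cancel[OF summable_hypergeo_2_1]) auto
    ultimately show ?thesis by (rule sums_unique2)
  qed
  show ?thesis
    unfolding continuable_def
    by (rule exI[of _ "\<lambda>z. I z / m 0"]) (use hol I_eq \<open>m 0 \<noteq> 0\<close> in \<open>auto intro!: holomorphic_intros\<close>)
qed

text \<open>Euler's integral applies to (A+p, B+p; C+p+q) once p and q are large: p raises Re B, and
  q raises Re (C-B), which p leaves unchanged. Lowering the last parameter q times and then all
  three p times returns to (A, B; C).\<close>

lemma continuable_hypergeo:
  assumes "C \<notin> \<int>\<^sub>\<le>\<^sub>0"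
  shows "continuable A B C"
proof -
  obtain p :: nat where p: "1 - Re B < real p"
    using reals_Archimedean2 by blast
  obtain q :: nat where q: "1 - Re (C - B) < real q"
    using reals_Archimedean2 by blast
  have "continuable (A + of_nat p) (B + of_nat p) (C + of_nat (p + q))"
    using p q by (intro continuable_Euler) auto
  then have "continuable (A + of_nat p) (B + of_nat p) (C + of_nat p)"
  proof (induction q)
    case (Suc q)
    then have "continuable (A + of_nat p) (B + of_nat p) ((C + of_nat (p + q)) + 1)"
      by (simp add: add_ac)
    then show ?case
      using add_of_nat_notin_nonpos_Ints[OF assms]
      by (intro Suc.IH) (rule continuable_decrease_C)
  qed simp
  then show ?thesis
  proof (induction p)
    case (Suc p)
    then have "continuable ((A + of_nat p) + 1) ((B + of_nat p) + 1) ((C + of_nat p) + 1)"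
      by (simp add: add_ac)
    then show ?case
      using add_of_nat_notin_nonpos_Ints[OF assms]
      by (intro Suc.IH) (rule continuable_decrease_all)
  qed simp
qed

section \<open>Pfaff's transformation\<close>

lemma binomial_series_complex:
  fixes s z :: complex
  assumes "norm z < 1"
  shows "((\<lambda>k. pochhammer s k / fact k * z ^ k) has_sum (1 - z) powr (-s)) UNIV"
proof (rule norm_summable_imp_has_sum)
  show "summable (\<lambda>k. norm (pochhammer s k / fact k * z ^ k))"
    using summable_hypergeo_2_1[of z s 1 1] assms by (simp add: pochhammer_fact[symmetric])
  have "((\<lambda>k. ((- s) gchoose k) * (- z) ^ k)) sums (1 + (- z)) powr (-s)"
    by (rule gen_binomial_complex) (use assms in simp)
  also have "(\<lambda>k. ((- s) gchoose k) * (- z) ^ k) = (\<lambda>k. pochhammer s k / fact k * z ^ k)"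
    by (simp add: fun_eq_iff gbinomial_pochhammer power_minus[of z] flip: power_add mult_2)
  finally show "(\<lambda>k. pochhammer s k / fact k * z ^ k) sums (1 - z) powr (-s)"
    by simp
qed

lemma binomial_series_real:
  fixes s r :: real
  assumes "0 \<le> r" "r < 1" "0 \<le> s"
  shows "((\<lambda>k. pochhammer s k / fact k * r ^ k) has_sum (1 - r) powr (-s)) UNIV"
proof -
  have "((\<lambda>k. Re (pochhammer (of_real s) k / fact k * of_real r ^ k)) has_sum Re ((1 - of_real r) powr (- of_real s))) UNIV"
    using assms by (intro has_sum_Re binomial_series_complex) auto
  moreover have "pochhammer (of_real s) k / fact k * of_real r ^ k = (of_real (pochhammer s k / fact k * r ^ k) :: complex)" for k
    by (simp add: pochhammer_of_real)
  moreover have "(1 - of_real r) powr (- of_real s) = (of_real ((1 - r) powr (-s)) :: complex)"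
    using assms by (simp flip: powr_of_real)
  ultimately show ?thesis
    by (simp only: Re_complex_of_real)
qed

lemma norm_pochhammer_le: "norm (pochhammer z n) \<le> pochhammer (norm z) n"
  for z :: "'a :: real_normed_field"
proof (induction n)
  case (Suc n)
  have "norm (z + of_nat n) \<le> norm z + of_nat n"
    using norm_triangle_ineq[of z "of_nat n"] by simp
  with Suc show ?case
    by (auto simp: pochhammer_Suc norm_mult intro!: mult_mono order_trans[OF norm_ge_zero Suc])
qed auto

lemma pochhammer_norm_nonneg: "pochhammer (norm z) n \<ge> 0"
  for z :: "'a :: real_normed_field"
  using norm_ge_zero norm_pochhammer_le by (rule order_trans)

text \<open>Expanding each (1-z)^(-B-k) on the right gives a double series; collecting the powers of
  z leaves a Chu-Vandermonde sum for every coefficient. The bound 1/2 on r = norm z makes r/(1-r) <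
  1, which is what absolute convergence of the double series requires.\<close>

lemma Pfaff_transformation_aux:
  fixes A B C z :: complex
  assumes C: "C \<notin> \<int>\<^sub>\<le>\<^sub>0" and z: "norm z < 1 / 2"
  shows "eval_fps (fps_hypergeo [A, B] [C] 1) z =
    (1 - z) powr (-B) * eval_fps (fps_hypergeo [C - A, B] [C] 1) (z / (z - 1))"
proof -
  define e where "e = (\<lambda>k. (-1) ^ k * pochhammer (C - A) k / (pochhammer C k * fact k))"
  \<comment> \<open>The double series, with (B)_k (B+k)_m already merged into (B)_(k+m).\<close>
  define a where "a = (\<lambda>(k, m). e k * (pochhammer B (k + m) / fact m * z ^ (k + m)))"
  define r where "r = norm z"
  define M where "M = (\<lambda>(k, m). norm (e k) * (pochhammer (norm B) (k + m) / fact m * r ^ (k + m)))"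
  have r: "0 \<le> r" "r < 1 / 2" using z by (auto simp: r_def)
  have "norm z < 1" "z \<noteq> 1" using z by auto
  have norm_w: "norm (z / (z - 1)) < 1"
  proof -
    have "1 \<le> norm z + norm (z - 1)"
      using norm_triangle_ineq[of z "1 - z"] by (simp add: norm_minus_commute)
    then have "norm z < norm (z - 1)" using z by linarith
    then show ?thesis by (simp add: norm_divide divide_simps)
  qed
  have "M summable_on UNIV \<times> UNIV"
  proof (rule summable_on_SigmaI)
    fix k :: nat
    have "((\<lambda>m. norm (e k) * (pochhammer (norm B) k * r ^ k) * (pochhammer (norm B + of_nat k) m / fact m * r ^ m)) has_sum
      (norm (e k) * (pochhammer (norm B) k * r ^ k) * (1 - r) powr (- (norm B + of_nat k)))) UNIV"
      using r by (intro has_sum_cmult_right binomial_series_real) auto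
    moreover have "M (k, m) = norm (e k) * (pochhammer (norm B) k * r ^ k) * (pochhammer (norm B + of_nat k) m / fact m * r ^ m)" for m
      by (simp add: M_def pochhammer_product' power_add mult_ac)
    ultimately show "((\<lambda>m. M (k, m)) has_sum
      (norm (e k) * (pochhammer (norm B) k * r ^ k) * (1 - r) powr (- (norm B + of_nat k)))) UNIV"
      by simp
  next
    \<comment> \<open>The row sums of the majorant are, up to the factor (1-r)^(-norm B), the norms
      of the terms of F(C-A, norm B; C) at r/(1-r).\<close>
    have "norm (complex_of_real (r / (1 - r))) < 1"
      unfolding norm_of_real using r by simp
    from summable_hypergeo_2_1[OF this, of "C - A" "of_real (norm B)" C]
    have "summable (\<lambda>k. norm (fps_nth (fps_hypergeo [C - A, complex_of_real (norm B)] [C] 1) k * of_real (r / (1 - r)) ^ k) * (1 - r) powr (- norm B))"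
      by (rule summable_mult2)
    moreover have "norm (fps_nth (fps_hypergeo [C - A, complex_of_real (norm B)] [C] 1) k * of_real (r / (1 - r)) ^ k) * (1 - r) powr (- norm B)
      = norm (e k) * (pochhammer (norm B) k * r ^ k) * (1 - r) powr (- (norm B + of_nat k))" for k
    proof -
      have "norm (pochhammer (complex_of_real (norm B)) k) = pochhammer (norm B) k"
        by (simp add: pochhammer_of_real pochhammer_norm_nonneg)
      moreover have "(1 - r) powr (- (norm B + of_nat k)) = (1 - r) powr (- norm B) / (1 - r) ^ k"
        using r by (simp add: powr_diff powr_realpow)
      moreover have "norm (1 - complex_of_real r) = 1 - r"
        using norm_of_real[of "1 - r", where 'a = complex] r by simp
      ultimately show ?thesis
        using r by (simp add: e_def norm_mult norm_divide norm_power power_divide mult_ac)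
    qed
    ultimately have "summable (\<lambda>k. norm (e k) * (pochhammer (norm B) k * r ^ k) * (1 - r) powr (- (norm B + of_nat k)))"
      by simp
    then show "(\<lambda>k. norm (e k) * (pochhammer (norm B) k * r ^ k) * (1 - r) powr (- (norm B + of_nat k))) summable_on UNIV"
      using r by (intro summable_nonneg_imp_summable_on) (auto intro!: mult_nonneg_nonneg pochhammer_norm_nonneg)
  next
    fix k m
    show "M (k, m) \<ge> 0"
      using r by (auto simp: M_def intro!: mult_nonneg_nonneg divide_nonneg_nonneg pochhammer_norm_nonneg)
  qed
  moreover have "norm (a p) \<le> M p" for p
    by (cases p) (auto simp: a_def M_def r_def norm_mult norm_divide norm_power
      intro!: mult_left_mono mult_right_mono divide_right_mono norm_pochhammer_le)
  ultimately have "(\<lambda>p. norm (a p)) summable_on UNIV \<times> UNIV"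
    by (rule summable_on_comparison_test) auto
  then have sum_a: "a summable_on UNIV \<times> UNIV"
    by (rule abs_summable_summable)
  have row: "((\<lambda>m. a (k, m)) has_sum ((1 - z) powr (-B) * (fps_nth (fps_hypergeo [C - A, B] [C] 1) k * (z / (z - 1)) ^ k))) UNIV" for k
  proof -
    have "((\<lambda>m. e k * (pochhammer B k * z ^ k) * (pochhammer (B + of_nat k) m / fact m * z ^ m)) has_sum
      (e k * (pochhammer B k * z ^ k) * (1 - z) powr (- (B + of_nat k)))) UNIV"
      using \<open>norm z < 1\<close> by (intro has_sum_cmult_right binomial_series_complex) auto
    moreover have "a (k, m) = e k * (pochhammer B k * z ^ k) * (pochhammer (B + of_nat k) m / fact m * z ^ m)" for m
      by (simp add: a_def pochhammer_product' power_add mult_ac)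
    moreover have "e k * (pochhammer B k * z ^ k) * (1 - z) powr (- (B + of_nat k)) =
      (1 - z) powr (-B) * (fps_nth (fps_hypergeo [C - A, B] [C] 1) k * (z / (z - 1)) ^ k)"
    proof -
      have "(z / (z - 1)) ^ k = (-1) ^ k * z ^ k / (1 - z) ^ k"
      proof -
        have "z / (z - 1) = -1 * z / (1 - z)"
          using \<open>z \<noteq> 1\<close> by (simp add: divide_simps) (simp add: algebra_simps)
        then show ?thesis
          by (simp only: power_divide power_mult_distrib)
      qed
      moreover have "(1 - z) powr (- (B + of_nat k)) = (1 - z) powr (-B) / (1 - z) ^ k"
        using \<open>z \<noteq> 1\<close> by (simp add: powr_diff powr_nat)
      ultimately show ?thesis by (simp add: e_def)
    qed
    ultimately show ?thesis by simp
  qed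
  have "infsum a (UNIV \<times> UNIV) = (\<Sum>\<^sub>\<infinity>k. (1 - z) powr (-B) * (fps_nth (fps_hypergeo [C - A, B] [C] 1) k * (z / (z - 1)) ^ k))"
    using infsum_Sigma_banach[OF sum_a] infsumI[OF row] by simp
  also have "\<dots> = (1 - z) powr (-B) * eval_fps (fps_hypergeo [C - A, B] [C] 1) (z / (z - 1))"
    unfolding eval_fps_def
    by (intro infsumI has_sum_cmult_right norm_summable_imp_has_sum summable_hypergeo_2_1 norm_w
        summable_sums summable_norm_cancel[OF summable_hypergeo_2_1])
  finally have eq1: "infsum a (UNIV \<times> UNIV) = \<dots>" .
  have bij: "bij_betw (\<lambda>(n, k). (k, n - k)) (SIGMA n:UNIV. {..n}) (UNIV \<times> (UNIV :: nat set))"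
    by (rule bij_betwI[of _ _ _ "\<lambda>(k, m). (k + m, k)"]) auto
  have sum_a': "(\<lambda>(n, k). a (k, n - k)) summable_on (SIGMA n:UNIV. {..n})"
    using summable_on_reindex_bij_betw[OF bij, of a] sum_a by (simp add: case_prod_unfold)
  \<comment> \<open>Writing 1/(n-k)! as (-1)^k (-n)_k / n! turns the diagonal into a Vandermonde sum
    with value (A)_n/(C)_n.\<close>
  have diag: "(\<Sum>k\<le>n. a (k, n - k)) = fps_nth (fps_hypergeo [A, B] [C] 1) n * z ^ n" for n
  proof -
    have "a (k, n - k) = pochhammer B n * z ^ n / fact n *
      (pochhammer (C - A) k * pochhammer (- of_nat n) k / (of_nat (fact k) * pochhammer C k))"
      if "k \<in> {0..n}" for k
    proof -
      have "pochhammer (- of_nat n :: complex) k = (-1) ^ k * (fact n / fact (n - k))"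
      proof -
        have "pochhammer (- of_nat n :: complex) k = (-1) ^ k * (of_nat (n choose k) * fact k)"
          by (simp add: binomial_gbinomial gbinomial_pochhammer flip: power_add mult_2 mult.assoc)
        then show ?thesis
          using that by (simp add: binomial_fact)
      qed
      then show ?thesis
        using that by (simp add: a_def e_def mult_ac)
    qed
    then have "(\<Sum>k\<le>n. a (k, n - k)) = (\<Sum>k\<in>{0..n}. pochhammer B n * z ^ n / fact n *
      (pochhammer (C - A) k * pochhammer (- of_nat n) k / (of_nat (fact k) * pochhammer C k)))"
      by (simp add: atLeast0AtMost)
    also have "\<dots> = pochhammer B n * z ^ n / fact n * (pochhammer (C - (C - A)) n / pochhammer C n)"
      unfolding sum_distrib_left[symmetric] using C by (subst Vandermonde_pochhammer) auto
    finally show ?thesis by (simp add: mult_ac)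
  qed
  have "infsum a (UNIV \<times> UNIV) = infsum (\<lambda>(n, k). a (k, n - k)) (SIGMA n:UNIV. {..n})"
    using infsum_reindex_bij_betw[OF bij, of a] by (simp add: case_prod_unfold)
  also have "\<dots> = (\<Sum>\<^sub>\<infinity>n. fps_nth (fps_hypergeo [A, B] [C] 1) n * z ^ n)"
    using infsum_Sigma_banach[OF sum_a'] diag by simp
  also have "\<dots> = eval_fps (fps_hypergeo [A, B] [C] 1) z"
    unfolding eval_fps_def using \<open>norm z < 1\<close>
    by (intro infsumI norm_summable_imp_has_sum summable_hypergeo_2_1
        summable_sums summable_norm_cancel[OF summable_hypergeo_2_1])
  finally show ?thesis
    using eq1 by simp
qed

text \<open>The right side of Pfaff's transformation is holomorphic wherever norm z < norm (z-1),
  which is the half-plane Re z < 1/2. The identity therefore spreads from the disc of radius 1/2 to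
  z = -1, where z/(z-1) = 1/2 and 1 - z = 2.\<close>

lemma hyp2F1_minus_one:
  assumes C: "C \<notin> \<int>\<^sub>\<le>\<^sub>0"
  shows "hyp2F1 A B C (-1) = 2 powr (-B) * eval_fps (fps_hypergeo [C - A, B] [C] 1) (1 / 2)"
proof -
  obtain f where f: "f holomorphic_on cut_plane"
    "\<And>u. u \<in> ball 0 1 \<Longrightarrow> f u = eval_fps (fps_hypergeo [A, B] [C] 1) u"
    using continuable_hypergeo[OF C] unfolding continuable_def by blast
  define H where "H = {z. Re z < 1 / 2}"
  define g where "g = (\<lambda>z. (1 - z) powr (-B) * eval_fps (fps_hypergeo [C - A, B] [C] 1) (z / (z - 1)))"
  have H: "open H" "connected H"
    unfolding H_def by (intro open_halfspace_Re_lt convex_connected convex_halfspace_Re_lt)+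
  have w: "norm (z / (z - 1)) < 1" if "z \<in> H" for z
  proof -
    have "z \<noteq> 1" using that by (auto simp: H_def)
    have "(norm z)\<^sup>2 < (norm (z - 1))\<^sup>2"
      unfolding cmod_power2 using that by (simp add: H_def power2_eq_square algebra_simps)
    then have "norm z < norm (z - 1)"
      by (rule power2_less_imp_less) simp
    then show ?thesis by (simp add: norm_divide divide_simps)
  qed
  have "g holomorphic_on H"
  proof -
    have "eval_fps (fps_hypergeo [C - A, B] [C] 1) \<circ> (\<lambda>z. z / (z - 1)) holomorphic_on H"
    proof (rule holomorphic_on_compose)
      show "(\<lambda>z. z / (z - 1)) holomorphic_on H"
        by (intro holomorphic_intros) (auto simp: H_def)
      show "eval_fps (fps_hypergeo [C - A, B] [C] 1) holomorphic_on (\<lambda>z. z / (z - 1)) ` H"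
        using w by (intro holomorphic_on_eval_fps) (auto simp: in_eball_iff intro!: norm_less_conv_radius_hypergeo_2_1)
    qed
    then show ?thesis
      unfolding g_def comp_def
      by (intro holomorphic_intros) (auto simp: H_def complex_nonpos_Reals_iff)
  qed
  moreover have "f holomorphic_on H"
    by (rule holomorphic_on_subset[OF f(1)]) (auto simp: H_def)
  moreover have "f z = g z" if "z \<in> ball 0 (1 / 2)" for z
    using that f(2)[of z] Pfaff_transformation_aux[OF C, of z A B] by (simp add: g_def)
  moreover have "ball 0 (1 / 2) \<subseteq> H"
  proof
    fix z :: complex assume "z \<in> ball 0 (1 / 2)"
    then show "z \<in> H" using abs_Re_le_cmod[of z] by (simp add: H_def)
  qed
  ultimately have "f (-1) = g (-1)"
    by (intro analytic_continuation_open[of "ball 0 (1 / 2)" H f g "-1"] H) (simp_all add: H_def)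
  moreover have "hyp2F1 A B C (-1) = f (-1)"
  proof (rule hyp2F1_eqI[OF f(1) _ f(2)])
    have "complex_of_real r \<noteq> -1" if "r \<ge> 1" for r
      using that by (simp add: complex_eq_iff)
    then show "-1 \<in> cut_plane" by force
  qed
  ultimately show ?thesis by (simp add: g_def)
qed

section \<open>Kummer's theorem\<close>

text \<open>The contiguous relation seen through Pfaff's transformation: replacing A by C - A - 1
  and taking z = 1/2 yields the relation at -1. It holds coefficient by coefficient.\<close>

lemma hypergeo_2_1_contiguous:
  fixes A B C z :: complex
  assumes C: "C \<notin> \<int>\<^sub>\<le>\<^sub>0" and z: "norm z < 1"
  shows "eval_fps (fps_hypergeo [A, B] [C] 1) z =
    (1 - z) * eval_fps (fps_hypergeo [A + 1, B] [C] 1) z +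
    (C - B) / C * z * eval_fps (fps_hypergeo [A + 1, B] [C + 1] 1) z"
proof -
  define G H where "G = fps_hypergeo [A + 1, B] [C] (1 :: complex)"
    and "H = fps_hypergeo [A + 1, B] [C + 1] (1 :: complex)"
  have eq: "fps_hypergeo [A, B] [C] 1 = G - fps_X * G + fps_const ((C - B) / C) * (fps_X * H)"
  proof (rule fps_ext)
    fix n
    show "fps_nth (fps_hypergeo [A, B] [C] 1) n = fps_nth (G - fps_X * G + fps_const ((C - B) / C) * (fps_X * H)) n"
    proof (cases n)
      case 0
      then show ?thesis by (simp add: G_def)
    next
      case (Suc k)
      have nz: "C \<noteq> 0" "C + of_nat k \<noteq> 0" "pochhammer C k \<noteq> 0" "fact k + fact k * of_nat k \<noteq> (0 :: complex)"
        using add_of_nat_neq_0[OF C, of 0] add_of_nat_neq_0[OF C, of k] pochhammer_neq_0[OF C]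
          fact_nonzero[of "Suc k", where 'a = complex] by (auto simp: algebra_simps)
      have shift: "pochhammer (C + 1) k = (C + of_nat k) * pochhammer C k / C"
        using nz by (simp flip: pochhammer_shift)
      show ?thesis
        using nz
        by (simp add: Suc G_def H_def pochhammer_rec[of A] pochhammer_Suc[of "A + 1"] pochhammer_Suc[of B]
            pochhammer_Suc[of C] shift divide_simps) (simp add: algebra_simps)
    qed
  qed
  have GH: "ereal (norm z) < fps_conv_radius G" "ereal (norm z) < fps_conv_radius H"
    unfolding G_def H_def using z by (auto intro!: norm_less_conv_radius_hypergeo_2_1)
  have mult: "ereal (norm z) < fps_conv_radius (f * g)"
    if "ereal (norm z) < fps_conv_radius f" "ereal (norm z) < fps_conv_radius g" for f g
    using that by (intro less_le_trans[OF _ fps_conv_radius_mult]) auto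
  have diff: "ereal (norm z) < fps_conv_radius (f - g)"
    if "ereal (norm z) < fps_conv_radius f" "ereal (norm z) < fps_conv_radius g" for f g
    using that by (intro less_le_trans[OF _ fps_conv_radius_diff]) auto
  show ?thesis
    unfolding eq using GH
    by (simp add: eval_fps_add eval_fps_diff eval_fps_mult mult diff flip: G_def H_def)
      (simp add: algebra_simps)
qed

text \<open>
  The first-order recurrence comes from a telescoping certificate \<open>g\<close> in the sense of Zeilberger;
  together with the limit 1 for \<open>c \<rightarrow> \<infinity>\<close> it gives the value as a quotient of Gamma products.
\<close>

lemma hypergeo_half_recurrence:
  fixes b c :: complex
  assumes c: "c \<notin> \<int>\<^sub>\<le>\<^sub>0"
  shows "c * (c + 1) * eval_fps (fps_hypergeo [1 - b, b] [c] 1) (1 / 2) =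
    (c + b) * (c + 1 - b) * eval_fps (fps_hypergeo [1 - b, b] [c + 2] 1) (1 / 2)"
proof -
  define t where "t = (\<lambda>c k. fps_nth (fps_hypergeo [1 - b, b] [c] 1) k * (1 / 2 :: complex) ^ k)"
  define g where "g = (\<lambda>k. - 2 * c * (c + 1) * (of_nat k / (c + of_nat k)) * t c k)"
  have sums: "t c sums eval_fps (fps_hypergeo [1 - b, b] [c] 1) (1 / 2)" for c
    unfolding t_def eval_fps_def
    by (intro summable_sums summable_norm_cancel[OF summable_hypergeo_2_1]) simp
  \<comment> \<open>Both t (c+2) k and t c (k+1) are rational multiples of t c k, so after
    cancelling it this is an identity between rational functions of k, b and c.\<close>
  have step: "c * (c + 1) * t c k - (c + b) * (c + 1 - b) * t (c + 2) k = g (Suc k) - g k" for k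
  proof -
    have nz: "c \<noteq> 0" "c + 1 \<noteq> 0" "c + of_nat k \<noteq> 0" "c + 1 + of_nat k \<noteq> 0" "pochhammer c k \<noteq> 0"
        "1 + of_nat k \<noteq> (0 :: complex)"
      using add_of_nat_neq_0[OF c, of 0] add_of_nat_neq_0[OF c, of 1] add_of_nat_neq_0[OF c, of k]
        add_of_nat_neq_0[OF c, of "Suc k"] pochhammer_neq_0[OF c] of_nat_neq_0[of k, where 'a = complex]
      by (simp_all add: add_ac)
    have "pochhammer (c + 1) k = (c + of_nat k) * pochhammer c k / c"
      using nz by (simp flip: pochhammer_shift)
    moreover have "pochhammer (c + 2) k = (c + 1 + of_nat k) * pochhammer (c + 1) k / (c + 1)"
      using nz pochhammer_shift[of "c + 1" k] by (simp add: field_simps)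
    ultimately have shift: "pochhammer (c + 2) k = (c + 1 + of_nat k) * (c + of_nat k) * pochhammer c k / (c * (c + 1))"
      by simp
    define T where "T = t c k"
    have t2: "t (c + 2) k = c * (c + 1) / ((c + of_nat k) * (c + 1 + of_nat k)) * T"
      unfolding T_def t_def hypergeo_2_1_nth shift using nz by (simp add: mult_ac)
    have t1: "t c (Suc k) = (1 - b + of_nat k) * (b + of_nat k) / (2 * (c + of_nat k) * (1 + of_nat k)) * T"
      unfolding T_def t_def hypergeo_2_1_nth by (simp add: pochhammer_Suc mult_ac)
    have g1: "g (Suc k) = - c * (c + 1) * (1 - b + of_nat k) * (b + of_nat k) / ((c + of_nat k) * (c + 1 + of_nat k)) * T"
    proof -
      have "c + of_nat (Suc k) = c + 1 + of_nat k" by simp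
      moreover have "c * 2 + of_nat k * 2 \<noteq> 0"
        using nz(3) by (metis distrib_right mult_eq_0_iff zero_neq_numeral)
      ultimately show ?thesis
        unfolding g_def t1 using nz by (simp add: divide_simps; simp add: algebra_simps)
    qed
    have g0: "g k = - 2 * c * (c + 1) * (of_nat k / (c + of_nat k)) * T"
      by (simp add: g_def T_def)
    show ?thesis
      unfolding g0 g1 t2 T_def[symmetric] using nz by (simp add: divide_simps) (simp add: algebra_simps)
  qed
  \<comment> \<open>As g 0 = 0 too, by its factor k, the telescoping sum has no boundary
    terms.\<close>
  have "g \<longlonglongrightarrow> 0"
  proof -
    have "(\<lambda>k. - 2 * c * (c + 1) * ((0 + of_nat k) / (c + of_nat k)) * t c k) \<longlonglongrightarrow> - 2 * c * (c + 1) * 1 * 0"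
      by (intro tendsto_intros ratio_tendsto_1 summable_LIMSEQ_zero sums_summable[OF sums])
    then show ?thesis by (simp add: g_def)
  qed
  from telescope_sums[OF this] have "(\<lambda>k. g (Suc k) - g k) sums (0 - g 0)" .
  moreover have "(\<lambda>k. c * (c + 1) * t c k - (c + b) * (c + 1 - b) * t (c + 2) k) sums
    (c * (c + 1) * eval_fps (fps_hypergeo [1 - b, b] [c] 1) (1 / 2) -
    (c + b) * (c + 1 - b) * eval_fps (fps_hypergeo [1 - b, b] [c + 2] 1) (1 / 2))"
    by (intro sums_diff sums_mult sums)
  ultimately have "c * (c + 1) * eval_fps (fps_hypergeo [1 - b, b] [c] 1) (1 / 2) -
    (c + b) * (c + 1 - b) * eval_fps (fps_hypergeo [1 - b, b] [c + 2] 1) (1 / 2) = 0 - g 0"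
    unfolding step by (rule sums_unique2[symmetric])
  then show ?thesis by (simp add: g_def)
qed

text \<open>The first factor is kept as norm c, because it alone produces the decay for large c; the
  factor c + j is merely bounded below by j.\<close>

lemma norm_pochhammer_ge:
  fixes c :: complex
  assumes "Re c \<ge> 1"
  shows "norm (pochhammer c (Suc k)) \<ge> norm c * fact k"
proof (induction k)
  case (Suc k)
  have "of_nat (Suc k) \<le> Re (c + of_nat (Suc k))"
    using assms by simp
  also have "\<dots> \<le> norm (c + of_nat (Suc k))"
    by (rule complex_Re_le_cmod)
  finally have "norm c * fact k * of_nat (Suc k) \<le> norm (pochhammer c (Suc k)) * norm (c + of_nat (Suc k))"
    using Suc by (intro mult_mono) auto
  then show ?case
    unfolding pochhammer_Suc[of c "Suc k"] norm_mult fact_Suc by (simp only: mult_ac of_nat_Suc)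
qed (use assms in simp)

text \<open>The constant term is 1, and the remaining terms are dominated by
  \<open>u k / norm c\<close> with a summable u that does not depend on c.\<close>

lemma hypergeo_half_limit:
  fixes b c :: complex
  shows "(\<lambda>n. eval_fps (fps_hypergeo [1 - b, b] [c + 2 * of_nat n] 1) (1 / 2)) \<longlonglongrightarrow> 1"
proof -
  define t where "t = (\<lambda>c k. fps_nth (fps_hypergeo [1 - b, b] [c] 1) k * (1 / 2 :: complex) ^ k)"
  have t_sums: "t c sums eval_fps (fps_hypergeo [1 - b, b] [c] 1) (1 / 2)" for c
    unfolding t_def eval_fps_def
    by (intro summable_sums summable_norm_cancel[OF summable_hypergeo_2_1]) simp
  \<comment> \<open>The factor k + 1 replaces (1)_(k+1) = (k+1)! in the denominator by k!, matching
    the lower bound for Pochhammer symbols above.\<close>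
  define u where "u = (\<lambda>k. norm (t 1 (Suc k)) * of_nat (Suc k))"
  have "summable u"
  proof -
    have "summable (\<lambda>k. norm (fps_nth (fps_hypergeo [2 - b, b + 1] [1] 1) k * (1 / 2 :: complex) ^ k))"
      by (rule summable_hypergeo_2_1) simp
    then have "summable (\<lambda>k. norm ((1 - b) * b / 2) * norm (fps_nth (fps_hypergeo [2 - b, b + 1] [1] 1) k * (1 / 2 :: complex) ^ k))"
      by (rule summable_mult)
    moreover have "norm (u k) \<le> norm ((1 - b) * b / 2) * norm (fps_nth (fps_hypergeo [2 - b, b + 1] [1] 1) k * (1 / 2 :: complex) ^ k)" for k
    proof -
      have "t 1 (Suc k) * of_nat (Suc k) = (1 - b) * b / 2 * (fps_nth (fps_hypergeo [2 - b, b + 1] [1] 1) k * (1 / 2 :: complex) ^ k) / of_nat (Suc k)"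
        using of_nat_neq_0[of k, where 'a = complex]
        by (simp add: t_def pochhammer_rec[of "1 - b"] pochhammer_rec[of b] pochhammer_fact[symmetric] mult_ac)
      then have "u k = norm ((1 - b) * b / 2) * norm (fps_nth (fps_hypergeo [2 - b, b + 1] [1] 1) k * (1 / 2 :: complex) ^ k) / of_nat (Suc k)"
        unfolding u_def by (metis norm_divide norm_mult norm_of_nat)
      also have "\<dots> \<le> norm ((1 - b) * b / 2) * norm (fps_nth (fps_hypergeo [2 - b, b + 1] [1] 1) k * (1 / 2 :: complex) ^ k) / 1"
        by (intro divide_left_mono) auto
      finally show ?thesis by (simp add: u_def)
    qed
    ultimately show ?thesis
      by (rule summable_comparison_test'[where N = 0])
  qed
  have bound: "norm (eval_fps (fps_hypergeo [1 - b, b] [c] 1) (1 / 2) - 1) \<le> suminf u / norm c" if c: "Re c \<ge> 1" for c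
  proof -
    have "c \<noteq> 0" using c by auto
    have le: "norm (t c (Suc k)) \<le> u k / norm c" for k
    proof -
      define X where "X = pochhammer (1 - b) (Suc k) * pochhammer b (Suc k) / fact (Suc k) * (1 / 2) ^ Suc k"
      have t_eq: "t d (Suc k) = X / pochhammer d (Suc k)" for d
        unfolding t_def hypergeo_2_1_nth X_def by (simp add: mult_ac del: pochhammer_Suc fact_Suc power_Suc of_nat_Suc)
      have pos: "0 < norm c * fact k"
        using \<open>c \<noteq> 0\<close> by simp
      have "norm (t c (Suc k)) = norm X / norm (pochhammer c (Suc k))"
        by (simp add: t_eq norm_divide)
      also have "\<dots> \<le> norm X / (norm c * fact k)"
        using norm_pochhammer_ge[OF c, of k] pos less_le_trans[OF pos norm_pochhammer_ge[OF c]]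
        by (intro divide_left_mono mult_pos_pos) auto
      also have "\<dots> = u k / norm c"
      proof -
        have n1: "norm (pochhammer (1 :: complex) (Suc k)) = of_nat (Suc k) * fact k"
          unfolding pochhammer_fact[symmetric] fact_Suc norm_mult norm_of_nat norm_fact ..
        have "u k = norm X / (of_nat (Suc k) * fact k) * of_nat (Suc k)"
          unfolding u_def t_eq norm_divide n1 ..
        also have "\<dots> = norm X / fact k"
          by (simp del: of_nat_Suc)
        finally have "u k = norm X / fact k" .
        then show ?thesis by (metis divide_divide_eq_left mult.commute)
      qed
      finally show ?thesis .
    qed
    have "(\<lambda>k. t c (Suc k)) sums (eval_fps (fps_hypergeo [1 - b, b] [c] 1) (1 / 2) - t c 0)"
      using t_sums by (simp add: sums_Suc_iff)
    then have eq: "eval_fps (fps_hypergeo [1 - b, b] [c] 1) (1 / 2) - 1 = (\<Sum>k. t c (Suc k))"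
      by (simp add: sums_iff t_def)
    have "norm (\<Sum>k. t c (Suc k)) \<le> (\<Sum>k. u k / norm c)"
      by (rule norm_suminf_le[OF le summable_divide[OF \<open>summable u\<close>]])
    then show ?thesis
      unfolding eq using \<open>summable u\<close> by (simp add: suminf_divide)
  qed
  have inf: "filterlim (\<lambda>n. norm (c + 2 * of_nat n)) at_top sequentially"
  proof (rule filterlim_at_top_mono)
    show "filterlim (\<lambda>n. Re c + 2 * of_nat n) at_top sequentially"
      by (intro filterlim_tendsto_add_at_top[OF tendsto_const] filterlim_tendsto_pos_mult_at_top[OF tendsto_const _ filterlim_real_sequentially]) auto
    show "eventually (\<lambda>n. Re c + 2 * of_nat n \<le> norm (c + 2 * of_nat n)) sequentially"
      using complex_Re_le_cmod[of "c + 2 * of_nat _"] by (intro always_eventually allI) simp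
  qed
  have "(\<lambda>n. eval_fps (fps_hypergeo [1 - b, b] [c + 2 * of_nat n] 1) (1 / 2) - 1) \<longlonglongrightarrow> 0"
  proof (rule Lim_null_comparison)
    have "eventually (\<lambda>n. real n \<ge> 1 - Re c) sequentially"
      using filterlim_real_sequentially unfolding filterlim_at_top by blast
    then show "eventually (\<lambda>n. norm (eval_fps (fps_hypergeo [1 - b, b] [c + 2 * of_nat n] 1) (1 / 2) - 1)
      \<le> suminf u / norm (c + 2 * of_nat n)) sequentially"
      by eventually_elim (rule bound, simp)
    show "(\<lambda>n. suminf u / norm (c + 2 * of_nat n)) \<longlonglongrightarrow> 0"
      by (rule real_tendsto_divide_at_top[OF tendsto_const inf])
  qed
  then show ?thesis by (simp add: LIM_zero_iff)
qed

lemma half_add_notin_nonpos_Ints: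
  fixes c :: complex
  assumes "c \<notin> \<int>\<^sub>\<le>\<^sub>0"
  shows "c / 2 \<notin> \<int>\<^sub>\<le>\<^sub>0" "(c + 1) / 2 \<notin> \<int>\<^sub>\<le>\<^sub>0"
proof -
  show "c / 2 \<notin> \<int>\<^sub>\<le>\<^sub>0"
  proof
    assume "c / 2 \<in> \<int>\<^sub>\<le>\<^sub>0"
    then obtain n where "c / 2 = - of_nat n" by (elim nonpos_Ints_cases')
    then have "c + of_nat (2 * n) = 0" by (simp add: field_simps)
    with add_of_nat_neq_0[OF assms] show False by blast
  qed
  show "(c + 1) / 2 \<notin> \<int>\<^sub>\<le>\<^sub>0"
  proof
    assume "(c + 1) / 2 \<in> \<int>\<^sub>\<le>\<^sub>0"
    then obtain n where n: "(c + 1) / 2 = - of_nat n" by (elim nonpos_Ints_cases')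
    have "c + of_nat (2 * n + 1) = 2 * ((c + 1) / 2 + of_nat n)" by (simp add: field_simps)
    also have "\<dots> = 0" unfolding n by simp
    finally show False using add_of_nat_neq_0[OF assms] by blast
  qed
qed

text \<open>Bailey's summation theorem. Iterating the recurrence produces a quotient of four
  Pochhammer symbols; these become truncated reciprocal Gamma functions, and n tends to infinity.
  Legendre's duplication formula merges the Gamma functions of c/2 and (c+1)/2 into Gamma c.\<close>

lemma hypergeo_half:
  fixes b c :: complex
  assumes c: "c \<notin> \<int>\<^sub>\<le>\<^sub>0"
  shows "eval_fps (fps_hypergeo [1 - b, b] [c] 1) (1 / 2) =
    2 powr (1 - c) * of_real (sqrt pi) * Gamma c * rGamma ((c + b) / 2) * rGamma ((c + 1 - b) / 2)"
proof -
  define K where "K = (\<lambda>c. eval_fps (fps_hypergeo [1 - b, b] [c] 1) (1 / 2))"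
  note c2 = half_add_notin_nonpos_Ints[OF c]
  have K_eq: "K c = pochhammer ((c + b) / 2) n * pochhammer ((c + 1 - b) / 2) n /
    (pochhammer (c / 2) n * pochhammer ((c + 1) / 2) n) * K (c + 2 * of_nat n)" for n
  proof (induction n)
    case (Suc n)
    define d where "d = c + 2 * of_nat n"
    have d: "d \<notin> \<int>\<^sub>\<le>\<^sub>0"
      using add_of_nat_notin_nonpos_Ints[OF c, of "2 * n"] by (simp add: d_def)
    have "d \<noteq> 0" "d + 1 \<noteq> 0"
      using add_of_nat_neq_0[OF d, of 0] add_of_nat_neq_0[OF d, of 1] by auto
    moreover have "d * (d + 1) * K d = (d + b) * (d + 1 - b) * K (d + 2)"
      using hypergeo_half_recurrence[OF d, of b] by (simp add: K_def)
    ultimately have "K d = (d + b) * (d + 1 - b) * K (d + 2) / (d * (d + 1))"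
      by (subst nonzero_eq_divide_eq) (simp_all add: mult_ac)
    then have "K d = (d + b) * (d + 1 - b) / (d * (d + 1)) * K (d + 2)"
      by simp
    also have "(d + b) * (d + 1 - b) / (d * (d + 1)) =
      ((c + b) / 2 + of_nat n) * ((c + 1 - b) / 2 + of_nat n) / ((c / 2 + of_nat n) * ((c + 1) / 2 + of_nat n))"
    proof -
      have "(c + b) / 2 + of_nat n = (d + b) / 2" "(c + 1 - b) / 2 + of_nat n = (d + 1 - b) / 2"
        "c / 2 + of_nat n = d / 2" "(c + 1) / 2 + of_nat n = (d + 1) / 2"
        by (simp_all add: d_def field_simps)
      then show ?thesis by (simp only:) simp
    qed
    also have "d + 2 = c + 2 * of_nat (Suc n)"
      by (simp add: d_def)
    finally show ?case
      using Suc by (simp add: d_def pochhammer_Suc mult_ac)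
  qed simp
  \<comment> \<open>The normalising powers of n and the factorials cancel because (c+b)/2 +
    (c+1-b)/2 = c/2 + (c+1)/2. Since \<open>rGamma_series z n\<close> contains n + 1 Pochhammer
    factors, the recurrence is used n + 1 times.\<close>
  have K_eq': "K c = rGamma_series ((c + b) / 2) n * rGamma_series ((c + 1 - b) / 2) n /
    (rGamma_series (c / 2) n * rGamma_series ((c + 1) / 2) n) * K (c + 2 * of_nat (Suc n))" for n
  proof -
    define l where "l = complex_of_real (ln (real n))"
    have "exp ((c + b) / 2 * l) * exp ((c + 1 - b) / 2 * l) = exp (c / 2 * l) * exp ((c + 1) / 2 * l)"
      unfolding exp_add[symmetric] by (rule arg_cong[where f = exp]) (simp add: field_simps)
    moreover have "p1 / (f * e1) * (p2 / (f * e2)) / (p3 / (f * e3) * (p4 / (f * e4))) = p1 * p2 / (p3 * p4)"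
      if "e1 * e2 = e3 * e4" "f \<noteq> 0" "e3 \<noteq> 0" "e4 \<noteq> 0" for p1 p2 p3 p4 e1 e2 e3 e4 f :: complex
    proof -
      have "p1 / (f * e1) * (p2 / (f * e2)) / (p3 / (f * e3) * (p4 / (f * e4))) =
        (p1 * p2) / (p3 * p4) * ((f * f * (e3 * e4)) / (f * f * (e1 * e2)))"
        by (simp add: mult_ac)
      also have "(f * f * (e3 * e4)) / (f * f * (e1 * e2)) = 1"
        unfolding that(1) using that(2-4) by simp
      finally show ?thesis by simp
    qed
    ultimately have "rGamma_series ((c + b) / 2) n * rGamma_series ((c + 1 - b) / 2) n /
      (rGamma_series (c / 2) n * rGamma_series ((c + 1) / 2) n) =
      pochhammer ((c + b) / 2) (Suc n) * pochhammer ((c + 1 - b) / 2) (Suc n) /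
      (pochhammer (c / 2) (Suc n) * pochhammer ((c + 1) / 2) (Suc n))"
      unfolding rGamma_series_def Suc_eq_plus1[symmetric] l_def[symmetric] by simp
    then show ?thesis
      by (simp only: K_eq[of "Suc n", symmetric])
  qed
  have "(\<lambda>n. rGamma_series ((c + b) / 2) n * rGamma_series ((c + 1 - b) / 2) n /
    (rGamma_series (c / 2) n * rGamma_series ((c + 1) / 2) n) * K (c + 2 * of_nat (Suc n)))
    \<longlonglongrightarrow> rGamma ((c + b) / 2) * rGamma ((c + 1 - b) / 2) / (rGamma (c / 2) * rGamma ((c + 1) / 2)) * 1"
    unfolding K_def
    by (intro tendsto_intros LIMSEQ_Suc[OF hypergeo_half_limit]) (use c2 in \<open>auto simp: rGamma_eq_zero_iff\<close>)
  then have "K c = rGamma ((c + b) / 2) * rGamma ((c + 1 - b) / 2) / (rGamma (c / 2) * rGamma ((c + 1) / 2)) * 1"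
    unfolding K_eq'[symmetric] by (rule LIMSEQ_unique[OF tendsto_const])
  then have "K c = rGamma ((c + b) / 2) * rGamma ((c + 1 - b) / 2) * (1 / (rGamma (c / 2) * rGamma ((c + 1) / 2)))"
    by simp
  also have "1 / (rGamma (c / 2) * rGamma ((c + 1) / 2)) = 2 powr (1 - c) * of_real (sqrt pi) * Gamma c"
  proof -
    have "Gamma (c / 2) * Gamma (c / 2 + 1 / 2) = exp ((1 - 2 * (c / 2)) * of_real (ln 2)) * of_real (sqrt pi) * Gamma (2 * (c / 2))"
      by (rule Gamma_legendre_duplication) (use c2 in \<open>simp_all add: add_divide_distrib\<close>)
    moreover have "exp ((1 - 2 * (c / 2)) * of_real (ln 2)) = 2 powr (1 - c)"
      by (simp add: powr_def flip: Ln_of_real)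
    moreover have "1 / (rGamma (c / 2) * rGamma ((c + 1) / 2)) = Gamma (c / 2) * Gamma (c / 2 + 1 / 2)"
      by (simp only: rGamma_inverse_Gamma add_divide_distrib divide_inverse[of 1 "_ * _"]
          inverse_mult_distrib inverse_inverse_eq mult_1)
    ultimately show ?thesis by (simp only:) simp
  qed
  finally show ?thesis
    unfolding K_def by (simp only: mult_ac)
qed

text \<open>With first parameter a - 1, Pfaff's transformation replaces it by (a-b) - (a-1) = 1 - b,
  exactly the shape of Bailey's theorem with c = a - b.\<close>

lemma hyp2F1_Kummer:
  assumes "a - b \<notin> \<int>\<^sub>\<le>\<^sub>0"
  shows "hyp2F1 (a - 1) b (a - b) (-1) = Gamma (a - b) * Gamma_quot1 a * rGamma ((a + 1) / 2 - b)"
proof -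
  have "hyp2F1 (a - 1) b (a - b) (-1) = 2 powr (-b) * eval_fps (fps_hypergeo [1 - b, b] [a - b] 1) (1 / 2)"
    by (simp add: hyp2F1_minus_one[OF assms])
  also have "\<dots> = (2 powr (-b) * 2 powr (1 - (a - b))) * of_real (sqrt pi) * Gamma (a - b) *
      rGamma (a / 2) * rGamma ((a + 1 - 2 * b) / 2)"
    by (simp add: hypergeo_half[OF assms] algebra_simps)
  also have "2 powr (-b) * 2 powr (1 - (a - b)) = (2 :: complex) powr (1 - a)"
    unfolding powr_add[symmetric] by simp
  also have "(a + 1 - 2 * b) / 2 = (a + 1) / 2 - b"
    by (simp add: field_simps)
  finally show ?thesis
    by (simp add: Gamma_quot1_eq mult_ac)
qed

section \<open>Reduction to a binomial sum\<close>

lemma hyp2F1_contiguous: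
  assumes C: "C \<notin> \<int>\<^sub>\<le>\<^sub>0"
  shows "hyp2F1 (A + 1) B C (-1) =
    (hyp2F1 A B C (-1) + (C - B) / C * hyp2F1 (A + 1) B (C + 1) (-1)) / 2"
proof -
  have C1: "C + 1 \<notin> \<int>\<^sub>\<le>\<^sub>0"
    using add_of_nat_notin_nonpos_Ints[OF C, of 1] by simp
  have "eval_fps (fps_hypergeo [C - (A + 1), B] [C] 1) (1 / 2) =
    (1 - 1 / 2) * eval_fps (fps_hypergeo [C - A, B] [C] 1) (1 / 2) +
    (C - B) / C * (1 / 2) * eval_fps (fps_hypergeo [C + 1 - (A + 1), B] [C + 1] 1) (1 / 2)"
    using hypergeo_2_1_contiguous[OF C, of "1 / 2" "C - (A + 1)" B] by (simp add: algebra_simps)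
  moreover define D where "D = (C - B) / C"
  ultimately show ?thesis
    unfolding hyp2F1_minus_one[OF C] hyp2F1_minus_one[OF C1] D_def[symmetric]
    by (simp only:) (simp add: algebra_simps)
qed

text \<open>The recursion applies (1 + S)/2, where S shifts j; its N-th power is expanded by
  Pascal's rule.\<close>

lemma binomial_iterate:
  fixes V :: "nat \<Rightarrow> nat \<Rightarrow> 'a :: field_char_0"
  assumes step: "\<And>N j. V (Suc N) j = (V N j + V N (Suc j)) / 2"
  shows "V N j = (\<Sum>i\<le>N. of_nat (N choose i) * V 0 (j + i)) / 2 ^ N"
proof (induction N arbitrary: j)
  case (Suc N)
  define v where "v = (\<lambda>i. V 0 (j + i))"
  have "(\<Sum>i\<le>Suc N. of_nat (Suc N choose i) * v i) =
    v 0 + (\<Sum>i\<le>N. of_nat (N choose Suc i) * v (Suc i)) + (\<Sum>i\<le>N. of_nat (N choose i) * v (Suc i))"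
    unfolding sum.atMost_Suc_shift by (simp add: algebra_simps sum.distrib)
  also have "v 0 + (\<Sum>i\<le>N. of_nat (N choose Suc i) * v (Suc i)) = (\<Sum>i\<le>Suc N. of_nat (N choose i) * v i)"
    unfolding sum.atMost_Suc_shift by simp
  also have "\<dots> = (\<Sum>i\<le>N. of_nat (N choose i) * v i)"
    by simp
  finally show ?case
    using Suc.IH[of j] Suc.IH[of "Suc j"] by (simp add: step v_def field_simps)
qed simp

lemma hyp2F1_minus_one_expansion:
  assumes "a - b \<notin> \<int>\<^sub>\<le>\<^sub>0"
  shows "hyp2F1 (a - 1 + of_nat N) b (a - b) (-1) =
    (\<Sum>i\<le>N. of_nat (N choose i) * (pochhammer (a - 2 * b) i * Gamma (a - b) *
      Gamma_quot1 (a + of_nat i) * rGamma ((a + of_nat i + 1) / 2 - b))) / 2 ^ N"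
proof -
  \<comment> \<open>The weight absorbs the factor (C-b)/C of the contiguous relation at C = a + j -
    b, which makes each step a plain average. Its denominator later cancels against Gamma
    (a+j-b).\<close>
  define V where "V = (\<lambda>N j. pochhammer (a - 2 * b) j / pochhammer (a - b) j *
    hyp2F1 (a + of_nat j - 1 + of_nat N) b (a + of_nat j - b) (-1))"
  have nonpos: "a + of_nat j - b \<notin> \<int>\<^sub>\<le>\<^sub>0" for j
    using add_of_nat_notin_nonpos_Ints[OF assms, of j] by (simp add: algebra_simps)
  have step: "V (Suc N) j = (V N j + V N (Suc j)) / 2" for N j
  proof -
    define p r where "p = pochhammer (a - 2 * b) j / pochhammer (a - b) j"
      and "r = (a + of_nat j - b - b) / (a + of_nat j - b)"
    define X Y where "X = hyp2F1 (a + of_nat j - 1 + of_nat N) b (a + of_nat j - b) (-1)"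
      and "Y = hyp2F1 (a + of_nat (Suc j) - 1 + of_nat N) b (a + of_nat (Suc j) - b) (-1)"
    have "a + of_nat j - 1 + of_nat (Suc N) = (a + of_nat j - 1 + of_nat N) + 1"
      by simp
    moreover have "(a + of_nat j - 1 + of_nat N) + 1 = a + of_nat (Suc j) - 1 + of_nat N"
      "(a + of_nat j - b) + 1 = a + of_nat (Suc j) - b"
      by simp_all
    ultimately have "hyp2F1 (a + of_nat j - 1 + of_nat (Suc N)) b (a + of_nat j - b) (-1) =
      (X + (a + of_nat j - b - b) / (a + of_nat j - b) * Y) / 2"
      unfolding X_def Y_def by (metis hyp2F1_contiguous[OF nonpos])
    then have V1: "V (Suc N) j = p * ((X + r * Y) / 2)"
      unfolding V_def p_def r_def by (simp only:)
    have "pochhammer (a - 2 * b) (Suc j) / pochhammer (a - b) (Suc j) = p * r"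
      by (simp add: p_def r_def pochhammer_Suc algebra_simps)
    then have V2: "V N (Suc j) = p * r * Y"
      unfolding V_def Y_def by (simp only:)
    have V3: "V N j = p * X"
      unfolding V_def p_def X_def ..
    show ?thesis
      unfolding V1 V2 V3 by (simp add: algebra_simps add_divide_distrib)
  qed
  have V0: "V 0 i = pochhammer (a - 2 * b) i * Gamma (a - b) *
      Gamma_quot1 (a + of_nat i) * rGamma ((a + of_nat i + 1) / 2 - b)" for i
  proof -
    have "pochhammer (a - b) i \<noteq> 0"
      using assms by (rule pochhammer_neq_0)
    moreover have "Gamma (a + of_nat i - b) = pochhammer (a - b) i * Gamma (a - b)"
      using pochhammer_Gamma[OF assms, of i] assms by (simp add: algebra_simps Gamma_eq_zero_iff)
    ultimately show ?thesis
      using hyp2F1_Kummer[OF nonpos, of i] by (simp add: V_def)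
  qed
  have "V N 0 = (\<Sum>i\<le>N. of_nat (N choose i) * V 0 (0 + i)) / 2 ^ N"
    by (rule binomial_iterate) (rule step)
  then show ?thesis
    unfolding add_0 V0 by (simp add: V_def)
qed

section \<open>Closed form of the Kummer terms, separately for even and odd shifts\<close>

lemma pochhammer_double_power4:
  "pochhammer (2 * z) (2 * k) = 4 ^ k * pochhammer z k * pochhammer (z + 1 / 2) k"
  for z :: "'a :: field_char_0"
  by (simp add: pochhammer_double power_mult)

lemma two_powr_diff_of_nat: "2 powr (z - of_nat m) = (2 powr z / 2 ^ m :: complex)"
  by (simp add: powr_diff powr_nat)

text \<open>Duplication splits (a-2b)_(2k) into 4^k times two symbols. One of them restores
  \<open>rGamma ((a + 1) / 2 - b)\<close>, the power of 4 cancels against that in the shifted Gamma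
  quotient, and the Gamma factors left over no longer depend on k.\<close>

lemma Kummer_term_even:
  assumes "pochhammer (a / 2) k \<noteq> 0"
  shows "pochhammer (a - 2 * b) (2 * k) * Gamma_quot1 (a + of_nat (2 * k)) *
      rGamma ((a + of_nat (2 * k) + 1) / 2 - b) =
    pochhammer (a / 2 - b) k / pochhammer (a / 2) k * Gamma_quot1 a * rGamma ((a + 1) / 2 - b)"
proof -
  define c where "c = complex_of_real (sqrt pi)"
  have "pochhammer (2 * (a / 2 - b)) (2 * k) = 4 ^ k * pochhammer (a / 2 - b) k * pochhammer (a / 2 - b + 1 / 2) k"
    by (rule pochhammer_double_power4)
  then have 1: "pochhammer (a - 2 * b) (2 * k) = 4 ^ k * pochhammer (a / 2 - b) k * pochhammer ((a + 1) / 2 - b) k"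
    by (simp add: algebra_simps add_divide_distrib)
  have "1 - (a + of_nat (2 * k)) = (1 - a) - of_nat (2 * k)" "(a + of_nat (2 * k)) / 2 = a / 2 + of_nat k"
    by (simp_all add: add_divide_distrib)
  then have 2: "Gamma_quot1 (a + of_nat (2 * k)) = 2 powr (1 - a) / 4 ^ k * c * rGamma (a / 2 + of_nat k)"
    unfolding Gamma_quot1_eq c_def by (simp only: two_powr_diff_of_nat) (simp add: power_mult)
  have 3: "rGamma (a / 2) = pochhammer (a / 2) k * rGamma (a / 2 + of_nat k)"
    by (rule pochhammer_rGamma)
  have 4: "rGamma ((a + 1) / 2 - b) = pochhammer ((a + 1) / 2 - b) k * rGamma ((a + of_nat (2 * k) + 1) / 2 - b)"
  proof -
    have "(a + 1) / 2 - b + of_nat k = (a + of_nat (2 * k) + 1) / 2 - b"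
      by (simp add: add_divide_distrib)
    then show ?thesis
      using pochhammer_rGamma[of "(a + 1) / 2 - b" k] by (simp only:)
  qed
  show ?thesis
    unfolding 1 2 4 Gamma_quot1_eq[of a] 3 c_def[symmetric] using assms by simp
qed

text \<open>An odd shift interchanges a/2 and (a+1)/2, which turns the first Gamma quotient into the
  second. The leading factor a - 2b = 2 (a/2 - b) supplies the missing step of the Gamma recurrence,
  and its 2 cancels the extra 1/2 from the power of 2.\<close>

lemma Kummer_term_odd:
  assumes "pochhammer ((a + 1) / 2) k \<noteq> 0"
  shows "pochhammer (a - 2 * b) (2 * k + 1) * Gamma_quot1 (a + of_nat (2 * k + 1)) *
      rGamma ((a + of_nat (2 * k + 1) + 1) / 2 - b) =
    pochhammer ((a + 1) / 2 - b) k / pochhammer ((a + 1) / 2) k * Gamma_quot2 a * rGamma (a / 2 - b)"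
proof -
  define c where "c = complex_of_real (sqrt pi)"
  have "pochhammer (2 * ((a + 1) / 2 - b)) (2 * k) = 4 ^ k * pochhammer ((a + 1) / 2 - b) k * pochhammer ((a + 1) / 2 - b + 1 / 2) k"
    by (rule pochhammer_double_power4)
  moreover have e: "2 * ((a + 1) / 2 - b) = a - 2 * b + 1" "(a + 1) / 2 - b + 1 / 2 = a / 2 - b + 1"
    by (simp_all add: field_simps)
  ultimately have "pochhammer (a - 2 * b + 1) (2 * k) = 4 ^ k * pochhammer ((a + 1) / 2 - b) k * pochhammer (a / 2 - b + 1) k"
    by (simp only: e)
  then have 1: "pochhammer (a - 2 * b) (2 * k + 1) = (a - 2 * b) * (4 ^ k * pochhammer ((a + 1) / 2 - b) k * pochhammer (a / 2 - b + 1) k)"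
    by (simp add: pochhammer_rec)
  have "1 - (a + of_nat (2 * k + 1)) = (1 - a) - of_nat (2 * k + 1)"
    "(a + of_nat (2 * k + 1)) / 2 = (a + 1) / 2 + of_nat k"
    by (simp_all add: add_divide_distrib)
  then have 2: "Gamma_quot1 (a + of_nat (2 * k + 1)) = 2 powr (1 - a) / (2 * 4 ^ k) * c * rGamma ((a + 1) / 2 + of_nat k)"
    unfolding Gamma_quot1_eq c_def by (simp only: two_powr_diff_of_nat) (simp add: power_mult)
  have 3: "rGamma ((a + 1) / 2) = pochhammer ((a + 1) / 2) k * rGamma ((a + 1) / 2 + of_nat k)"
    by (rule pochhammer_rGamma)
  have "rGamma (a / 2 - b) = (a / 2 - b) * (pochhammer (a / 2 - b + 1) k * rGamma (a / 2 - b + 1 + of_nat k))"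
    by (metis rGamma_plus1 pochhammer_rGamma)
  also have "a / 2 - b + 1 + of_nat k = (a + of_nat (2 * k + 1) + 1) / 2 - b"
    by (simp add: field_simps)
  finally have 4: "rGamma (a / 2 - b) = (a - 2 * b) / 2 * (pochhammer (a / 2 - b + 1) k * rGamma ((a + of_nat (2 * k + 1) + 1) / 2 - b))"
    by (simp add: diff_divide_distrib)
  show ?thesis
    unfolding 1 2 4 Gamma_quot2_eq[of a] 3 c_def[symmetric] using assms by simp
qed

section \<open>Binomial coefficients and the terminating 3F2 sums\<close>

lemma fact_double:
  "(fact (2 * k) :: 'a :: field_char_0) = 4 ^ k * (pochhammer (1 / 2) k * fact k)"
  "(fact (2 * k + 1) :: 'a) = 4 ^ k * (pochhammer (3 / 2) k * fact k)"
proof -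
  have "(fact (2 * k) :: 'a) = pochhammer (2 * (1 / 2)) (2 * k)"
    by (simp add: pochhammer_fact)
  also have "\<dots> = 4 ^ k * pochhammer (1 / 2) k * pochhammer (1 / 2 + 1 / 2) k"
    by (rule pochhammer_double_power4)
  finally show "(fact (2 * k) :: 'a) = 4 ^ k * (pochhammer (1 / 2) k * fact k)"
    by (simp add: pochhammer_fact)
  have "(fact (2 * k + 1) :: 'a) = 1 * pochhammer (1 + 1) (2 * k)"
    unfolding pochhammer_fact Suc_eq_plus1[symmetric] pochhammer_rec ..
  also have "\<dots> = pochhammer (2 * 1) (2 * k)"
    by simp
  also have "\<dots> = 4 ^ k * pochhammer 1 k * pochhammer (1 + 1 / 2) k"
    by (rule pochhammer_double_power4)
  finally show "(fact (2 * k + 1) :: 'a) = 4 ^ k * (pochhammer (3 / 2) k * fact k)"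
    by (simp add: pochhammer_fact mult_ac)
qed

text \<open>For N = n + 1 the numerators are Pochhammer symbols of -(n+1)/2 and -n/2, the first two
  upper parameters in P(n).\<close>

lemma binomial_even:
  "of_nat (N choose (2 * k)) = (pochhammer (- of_nat N / 2) k * pochhammer ((1 - of_nat N) / 2) k / (pochhammer (1 / 2) k * fact k) :: 'a :: field_char_0)"
proof -
  have "(of_nat (N choose (2 * k)) :: 'a) = pochhammer (2 * (- of_nat N / 2)) (2 * k) / fact (2 * k)"
    by (simp add: binomial_gbinomial gbinomial_pochhammer)
  also have "pochhammer (2 * (- of_nat N / 2 :: 'a)) (2 * k) =
    4 ^ k * pochhammer (- of_nat N / 2) k * pochhammer (- of_nat N / 2 + 1 / 2) k"
    by (rule pochhammer_double_power4)
  also have "- of_nat N / 2 + 1 / 2 = (1 - of_nat N) / (2 :: 'a)"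
    by (simp add: field_simps)
  finally show ?thesis
    by (simp add: fact_double)
qed

text \<open>Splitting off the factor N from (-N)_(2k+1) before duplication is the origin of the
  prefactor n + 1 in Q(n).\<close>

lemma binomial_odd:
  "of_nat (N choose (2 * k + 1)) = (of_nat N * (pochhammer ((2 - of_nat N) / 2) k * pochhammer ((1 - of_nat N) / 2) k / (pochhammer (3 / 2) k * fact k)) :: 'a :: field_char_0)"
proof -
  have "(of_nat (N choose (2 * k + 1)) :: 'a) = of_nat N * pochhammer (2 * ((1 - of_nat N) / 2)) (2 * k) / fact (2 * k + 1)"
  proof -
    have "2 * (x / 2) = x" for x :: 'a by simp
    then show ?thesis
      by (simp only:) (simp add: binomial_gbinomial gbinomial_pochhammer pochhammer_rec)
  qed
  also have "pochhammer (2 * ((1 - of_nat N) / 2 :: 'a)) (2 * k) =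
    4 ^ k * pochhammer ((1 - of_nat N) / 2) k * pochhammer ((1 - of_nat N) / 2 + 1 / 2) k"
    by (rule pochhammer_double_power4)
  also have "(1 - of_nat N) / 2 + 1 / 2 = (2 - of_nat N) / (2 :: 'a)"
    by (simp add: field_simps)
  finally show ?thesis
    unfolding fact_double by (simp add: mult_ac)
qed

text \<open>Which of the two upper parameters is a non-positive integer depends on the parity of n,
  so termination is expressed through the product.\<close>

lemma hyp3F2_eq_sum:
  assumes "\<And>k. k > N \<Longrightarrow> pochhammer A k * pochhammer B k = 0"
  shows "hyp3F2 A B C E F = (\<Sum>k\<le>N. pochhammer A k * pochhammer B k * pochhammer C k / (pochhammer E k * pochhammer F k * fact k))"
  unfolding hyp3F2_def eval_fps_def
  by (subst suminf_finite[of "{..N}"]) (use assms in auto)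

lemma P_coeff_eq:
  assumes "n = int N - 1"
  shows "P_coeff n a b = (\<Sum>k\<le>N. of_nat (N choose (2 * k)) * (pochhammer (a / 2 - b) k / pochhammer (a / 2) k)) / 2 ^ N"
proof -
  have eqs: "- (of_int n / 2) = (1 - of_nat N) / (2 :: complex)" "- ((of_int n + 1) / 2) = - of_nat N / (2 :: complex)"
    "2 powi (n + 1) = (2 ^ N :: complex)"
    unfolding assms by (simp_all add: field_simps)
  \<comment> \<open>Read in this direction, the formula gives termination without a case split on
    parity: the binomial coefficient is 0 for 2k > N.\<close>
  have "pochhammer ((1 - of_nat N) / 2 :: complex) k * pochhammer (- of_nat N / 2) k =
      of_nat (N choose (2 * k)) * (pochhammer (1 / 2) k * fact k)" for k
    using fact_nonzero[of "2 * k", where 'a = complex] unfolding fact_double binomial_even by simp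
  then have *: "hyp3F2 ((1 - of_nat N) / 2) (- of_nat N / 2) (a / 2 - b) (1 / 2) (a / 2) =
    (\<Sum>k\<le>N. pochhammer ((1 - of_nat N) / 2) k * pochhammer (- of_nat N / 2) k * pochhammer (a / 2 - b) k /
      (pochhammer (1 / 2) k * pochhammer (a / 2) k * fact k))"
    by (intro hyp3F2_eq_sum) simp
  show ?thesis
    unfolding P_coeff_def eqs * binomial_even by (simp add: mult_ac)
qed

lemma Q_coeff_eq:
  assumes "n = int N - 1"
  shows "Q_coeff n a b = (\<Sum>k\<le>N. of_nat (N choose (2 * k + 1)) * (pochhammer ((a + 1) / 2 - b) k / pochhammer ((a + 1) / 2) k)) / 2 ^ N"
\<comment> \<open>For N = 0 the first two upper parameters are 1 and 1/2 and need not terminate the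
  series; the prefactor n + 1 = 0 settles this case.\<close>
proof (cases "N = 0")
  case True
  then show ?thesis using assms by (simp add: Q_coeff_def)
next
  case False
  have eqs: "- ((of_int n - 1) / 2) = (2 - of_nat N) / (2 :: complex)" "- (of_int n / 2) = (1 - of_nat N) / (2 :: complex)"
    "of_int n + 1 = (of_nat N :: complex)" "2 powi (n + 1) = (2 ^ N :: complex)"
    unfolding assms by (simp_all add: field_simps)
  have "pochhammer ((2 - of_nat N) / 2 :: complex) k * pochhammer ((1 - of_nat N) / 2) k = 0" if "k > N" for k
  proof -
    have "(of_nat (N choose (2 * k + 1)) :: complex) = 0"
      using that by simp
    moreover have "pochhammer (3 / 2 :: complex) k * fact k \<noteq> 0"
      using fact_nonzero[of "2 * k + 1", where 'a = complex] unfolding fact_double by auto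
    ultimately show ?thesis
      using False unfolding binomial_odd by simp
  qed
  then have *: "hyp3F2 ((2 - of_nat N) / 2) ((1 - of_nat N) / 2) ((a + 1) / 2 - b) (3 / 2) ((a + 1) / 2) =
    (\<Sum>k\<le>N. pochhammer ((2 - of_nat N) / 2) k * pochhammer ((1 - of_nat N) / 2) k * pochhammer ((a + 1) / 2 - b) k /
      (pochhammer (3 / 2) k * pochhammer ((a + 1) / 2) k * fact k))"
    by (intro hyp3F2_eq_sum) simp
  show ?thesis
    unfolding Q_coeff_def eqs * binomial_odd by (simp add: sum_distrib_left sum_divide_distrib mult_ac)
qed

lemma sum_even_odd:
  fixes f :: "nat \<Rightarrow> 'a :: comm_monoid_add"
  assumes "\<And>i. i > N \<Longrightarrow> f i = 0"
  shows "(\<Sum>i\<le>N. f i) = (\<Sum>k\<le>N. f (2 * k)) + (\<Sum>k\<le>N. f (2 * k + 1))"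
proof -
  have split: "(\<Sum>i<2 * m. f i) = (\<Sum>k<m. f (2 * k)) + (\<Sum>k<m. f (2 * k + 1))" for m
    by (induction m) (simp_all add: add_ac)
  have "(\<Sum>i\<le>N. f i) = (\<Sum>i<2 * Suc N. f i)"
    using assms by (intro sum.mono_neutral_left) auto
  then show ?thesis
    unfolding split by (simp add: lessThan_Suc_atMost)
qed

theorem theorem1:
  fixes n :: int and a b :: complex
  assumes "n \<ge> 0 \<or> n = -1"
    and "n \<ge> 0 \<Longrightarrow> pochhammer a (nat n) \<noteq> 0"
    and "a - b \<notin> \<int>\<^sub>\<le>\<^sub>0"
  shows "hyp2F1 (a + of_int n) b (a - b) (-1) =
      P_coeff n a b * (Gamma (a - b) * Gamma_quot1 a * rGamma ((a + 1) / 2 - b))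
    + Q_coeff n a b * (Gamma (a - b) * Gamma_quot2 a * rGamma (a / 2 - b))"
proof -
  define N where "N = nat (n + 1)"
  have n: "n = int N - 1"
    using assms(1) by (auto simp: N_def)
  \<comment> \<open>The factors of (a)_n are those with i < n = N - 1. For n = -1 there is no such
    i.\<close>
  have a_neq: "a + of_nat i \<noteq> 0" if "Suc i < N" for i
    using that n assms(2) by (auto simp: pochhammer_eq_0_iff add_eq_0_iff2)
  define T where "T = (\<lambda>i. of_nat (N choose i) * (pochhammer (a - 2 * b) i * Gamma (a - b) *
      Gamma_quot1 (a + of_nat i) * rGamma ((a + of_nat i + 1) / 2 - b)))"
  have even: "T (2 * k) = of_nat (N choose (2 * k)) * (pochhammer (a / 2 - b) k / pochhammer (a / 2) k) *
    (Gamma (a - b) * Gamma_quot1 a * rGamma ((a + 1) / 2 - b))" for k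
  \<comment> \<open>Only here must (a/2)_k be nonzero: its zeros would come from a + 2i = 0 with 2i
    <= N - 2. For 2k > N the binomial coefficient makes both sides 0.\<close>
  proof (cases "2 * k \<le> N")
    case True
    have "pochhammer (a / 2) k \<noteq> 0"
    proof
      assume "pochhammer (a / 2) k = 0"
      then obtain i where "i < k" "a / 2 = - of_nat i"
        by (auto simp: pochhammer_eq_0_iff)
      then show False using a_neq[of "2 * i"] True by (simp add: field_simps)
    qed
    from Kummer_term_even[OF this, of b] show ?thesis
      by (simp add: T_def mult_ac)
  qed (simp add: T_def binomial_eq_0)
  have odd: "T (2 * k + 1) = of_nat (N choose (2 * k + 1)) * (pochhammer ((a + 1) / 2 - b) k / pochhammer ((a + 1) / 2) k) *
    (Gamma (a - b) * Gamma_quot2 a * rGamma (a / 2 - b))" for k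
  proof (cases "2 * k + 1 \<le> N")
    case True
    have "pochhammer ((a + 1) / 2) k \<noteq> 0"
    proof
      assume "pochhammer ((a + 1) / 2) k = 0"
      then obtain i where "i < k" and i: "(a + 1) / 2 = - of_nat i"
        by (auto simp: pochhammer_eq_0_iff)
      have "a + of_nat (2 * i + 1) = 2 * ((a + 1) / 2 + of_nat i)"
        by (simp add: field_simps)
      also have "\<dots> = 0" unfolding i by simp
      finally show False using a_neq[of "2 * i + 1"] True \<open>i < k\<close> by simp
    qed
    from Kummer_term_odd[OF this, of b] show ?thesis
      by (simp add: T_def mult_ac)
  qed (simp add: T_def binomial_eq_0)
  have "hyp2F1 (a + of_int n) b (a - b) (-1) = hyp2F1 (a - 1 + of_nat N) b (a - b) (-1)"
    by (simp add: n algebra_simps)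
  also have "\<dots> = (\<Sum>i\<le>N. T i) / 2 ^ N"
    unfolding T_def by (rule hyp2F1_minus_one_expansion[OF assms(3)])
  also have "(\<Sum>i\<le>N. T i) = (\<Sum>k\<le>N. T (2 * k)) + (\<Sum>k\<le>N. T (2 * k + 1))"
    by (rule sum_even_odd) (simp add: T_def binomial_eq_0)
  finally show ?thesis
    unfolding P_coeff_eq[OF n] Q_coeff_eq[OF n] even odd sum_distrib_right[symmetric]
    by (simp add: add_divide_distrib)
qed

end
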